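(* Let $G=(V,q)$ be a finite reversible graph with reversible measure $m$, satisfying $CD(0,n)$ for some $n<\infty$. Let $r\ge 4n^2D/q_{\min}$ and $x\in V$. Then $$\frac{m(B_{2r}(x))}{m(B_r(x))}\le\left(9n\sqrt{\frac{D}{q_{\min}}}\right)^{3n}.$$
   Context: A finite graph $G=(V,q)$ consists of a finite set $V$ and a function $q:V^2\to[0,\infty)$ with $q(x,x)=0$ for all $x\in V$. It is called reversible if there is a function $m:V\to(0,\infty)$ (a reversible measure) with $q(x,y)m(x)=q(y,x)m(y)$ for all $x,y\in V$; for $A\subseteq V$, $m(A)=\sum_{x\in A}m(x)$. Write $x\sim y$ if $q(x,y)>0$ or $q(y,x)>0$. The combinatorial distance is $d(x,y)=\inf\{k: x=x_0\sim\cdots\sim x_k=y\}$ ($\infty$ if there is no such path), and $B_r(x)=\{y\in V:d(x,y)\le r\}$. Put $q_{\min}:=\min\{q(x,y):x,y\in V,\ q(x,y)>0\}$ (this presupposes that $q$ is not identically zero) and $D:=\max_x\sum_y q(x,y)$. $C(V)=\mathbb{R}^V$. The Laplacian is $\Delta f(x)=\sum_{y}q(x,y)(f(y)-f(x))$. The operators $\Gamma_k:C(V)\times C(V)\to C(V)$ are defined by $\Gamma_0(f,g)=fg$ and $2\Gamma_{k+1}(f,g)=\Delta\Gamma_k(f,g)-\Gamma_k(f,\Delta g)-\Gamma_k(\Delta f,g)$; write $\Gamma_k f=\Gamma_k(f,f)$ and $\Gamma=\Gamma_1$. $G$ satisfies $CD(K,n)$ (with $K\in\mathbb{R}$, $n\in(0,\infty]$,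 $1/\infty=0$) if $\Gamma_2 f\ge\frac1n(\Delta f)^2+K\,\Gamma f$ pointwise on $V$ for all $f\in C(V)$. *)

theory Defs
  imports Complex_Main "HOL-Library.Extended_Real"
begin

(* The finite vertex set V is the universe of a type of class finite, so C(V) is 'v => real. *)

definition finite_graph :: "('v::finite \<Rightarrow> 'v \<Rightarrow> real) \<Rightarrow> bool" where
  "finite_graph q \<longleftrightarrow> (\<forall>x y. 0 \<le> q x y) \<and> (\<forall>x. q x x = 0)"

definition reversible_measure :: "('v::finite \<Rightarrow> 'v \<Rightarrow> real) \<Rightarrow> ('v \<Rightarrow> real) \<Rightarrow> bool" where
  "reversible_measure q m \<longleftrightarrow> (\<forall>x. 0 < m x) \<and> (\<forall>x y. q x y * m x = q y x * m y)"

definition vol :: "('v::finite \<Rightarrow> real) \<Rightarrow> 'v set \<Rightarrow> real" where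
  "vol m A = (\<Sum>x\<in>A. m x)"

definition adj :: "('v::finite \<Rightarrow> 'v \<Rightarrow> real) \<Rightarrow> 'v \<Rightarrow> 'v \<Rightarrow> bool" where
  "adj q x y \<longleftrightarrow> 0 < q x y \<or> 0 < q y x"

(* The relation power (adj q ^^ k) x y says that some path x = x_0 ~ ... ~ x_k = y exists;
   the infimum over the empty set in enat is infinity. *)
definition gdist :: "('v::finite \<Rightarrow> 'v \<Rightarrow> real) \<Rightarrow> 'v \<Rightarrow> 'v \<Rightarrow> enat" where
  "gdist q x y = Inf {enat k | k. (adj q ^^ k) x y}"

definition gball :: "('v::finite \<Rightarrow> 'v \<Rightarrow> real) \<Rightarrow> real \<Rightarrow> 'v \<Rightarrow> 'v set" where
  "gball q r x = {y. ereal_of_enat (gdist q x y) \<le> ereal r}"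

(* Only meaningful if q is not identically zero; otherwise Min is taken over the empty set. *)
definition qmin :: "('v::finite \<Rightarrow> 'v \<Rightarrow> real) \<Rightarrow> real" where
  "qmin q = Min {q x y | x y. 0 < q x y}"

definition maxdeg :: "('v::finite \<Rightarrow> 'v \<Rightarrow> real) \<Rightarrow> real" where
  "maxdeg q = Max (range (\<lambda>x. \<Sum>y\<in>UNIV. q x y))"

definition laplacian :: "('v::finite \<Rightarrow> 'v \<Rightarrow> real) \<Rightarrow> ('v \<Rightarrow> real) \<Rightarrow> 'v \<Rightarrow> real" where
  "laplacian q f x = (\<Sum>y\<in>UNIV. q x y * (f y - f x))"

primrec Gamma_op ::
  "('v::finite \<Rightarrow> 'v \<Rightarrow> real) \<Rightarrow> nat \<Rightarrow> ('v \<Rightarrow> real) \<Rightarrow> ('v \<Rightarrow> real) \<Rightarrow> 'v \<Rightarrow> real" where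
  "Gamma_op q 0 f g = (\<lambda>x. f x * g x)"
| "Gamma_op q (Suc k) f g =
     (\<lambda>x. (laplacian q (Gamma_op q k f g) x
           - Gamma_op q k f (laplacian q g) x
           - Gamma_op q k (laplacian q f) g x) / 2)"

(* The dimension n ranges over (0, infinity]. In ereal, inverse infinity = 0, as required;
   n > 0 is part of the condition because real_of_ereal (inverse 0) = 0. *)
definition CD :: "('v::finite \<Rightarrow> 'v \<Rightarrow> real) \<Rightarrow> real \<Rightarrow> ereal \<Rightarrow> bool" where
  "CD q K n \<longleftrightarrow> 0 < n \<and>
     (\<forall>f x. Gamma_op q 2 f f x \<ge>
        real_of_ereal (inverse n) * (laplacian q f x)\<^sup>2 + K * Gamma_op q 1 f f x)"

end

theory Submission
  imports Defs "HOL-Analysis.Analysis"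
begin

text \<open>
  The heat semigroup is replaced by the flow \<open>u' = \<Delta> u + \<Gamma> u\<close>, the equation satisfied by the logarithm of a heat
  solution on a manifold. \<open>CD(0, n)\<close> and the maximum principle show that an initial bound
  \<open>\<Gamma> u \<le> q\<^sub>m\<^sub>i\<^sub>n / (2 n)\<close> is preserved and that \<open>- \<Delta> u \<le> n / (2 \<tau>)\<close> with \<open>\<tau> = t + t\<^sub>0\<close>; integrating along
  paths gives a parabolic Harnack inequality.

  For \<open>\<alpha> = 1 + 1 / (8 n)\<close> the mass \<open>A = \<Sum> m e\<^bsup>\<alpha> u\<^esup>\<close> decreases, but at rate at most \<open>A / (16 \<tau>)\<close>, and Li--Yau
  makes it spread only diffusively: a 1-Lipschitz mean grows by at most \<open>O(\<surd>(D n \<tau>))\<close>.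
  Start from \<open>u = - d(x, \<cdot>) / w\<close> with \<open>w\<^sup>2 = n D / q\<^sub>m\<^sub>i\<^sub>n\<close>, so that the hypothesis reads \<open>r \<ge> 4 n w\<^sup>2\<close>. The Harnack
  inequality from \<open>x\<close> bounds \<open>m(B\<^sub>k)\<close> by \<open>A(0)\<close> times a power of \<open>k\<close>, hence the initial mass outside \<open>B\<^sub>r\<close> is a
  fraction of \<open>A(0)\<close>. If \<open>r \<le> 12 n w\<^sup>2\<close>, this compares \<open>m(B\<^sub>2\<^sub>r)\<close> with \<open>A(0)\<close> and \<open>A(0)\<close> with \<open>m(B\<^sub>r)\<close>.
  For larger \<open>r\<close>, half of the mass is still inside \<open>B\<^sub>r\<close> at time \<open>r\<^sup>2 / (100 D n)\<close>, and the Harnack inequality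
  between this time and a time of order \<open>r\<^sup>2 / (n q\<^sub>m\<^sub>i\<^sub>n)\<close> spreads it evenly over \<open>B\<^sub>2\<^sub>r\<close>.
\<close>

section \<open>Ordinary differential equations and the maximum principle\<close>

text \<open>Picard iteration for candidate solutions divided by \<open>exp (2 * L * t)\<close>: the
  weight makes the integral operator a contraction with factor 1/2 on the whole half-line, and
  boundedness of \<open>F\<close> keeps its images among the bounded continuous functions.\<close>

lemma lipschitz_bounded_ode_solution:
  fixes F :: "'a::euclidean_space \<Rightarrow> 'a"
  assumes lip: "\<And>a b. norm (F a - F b) \<le> L * norm (a - b)"
    and bd: "\<And>a. norm (F a) \<le> C" and L: "L > 0"
  shows "\<exists>u. u 0 = a0 \<and> (\<forall>t\<ge>0. (u has_vector_derivative F (u t)) (at t))"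
proof -
  have Fcont: "continuous_on UNIV F"
    by (rule lipschitz_on_continuous_on[of L]) (use lip L in \<open>auto simp: lipschitz_on_def dist_norm\<close>)
  have C: "C \<ge> 0" using bd norm_ge_zero order_trans by blast
  define I where "I w = (\<lambda>t. integral {0..max 0 t} (\<lambda>s. F (exp (2 * L * s) *\<^sub>R apply_bcontfun w s)))"
    for w :: "real \<Rightarrow>\<^sub>C 'a"
  define G where "G w = (\<lambda>t. exp (- (2 * L * max 0 t)) *\<^sub>R (a0 + I w t))" for w
  have hcont: "continuous_on S (\<lambda>s. F (exp (2 * L * s) *\<^sub>R apply_bcontfun w s))" for w S
    by (rule continuous_on_compose2[OF Fcont]) (auto intro!: continuous_intros)
  have hint: "(\<lambda>s. F (exp (2 * L * s) *\<^sub>R apply_bcontfun w s)) integrable_on {a..b}" for w a b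
    by (rule integrable_continuous_interval[OF hcont])
  have Icont: "continuous_on UNIV (I w)" for w
  proof -
    have "continuous_on {..b} (I w)" for b
      unfolding I_def
    proof (rule continuous_on_compose2[where g = "\<lambda>t. integral {0..t} (\<lambda>s. F (exp (2 * L * s) *\<^sub>R apply_bcontfun w s))"])
      show "continuous_on {0..max 0 b} (\<lambda>t. integral {0..t} (\<lambda>s. F (exp (2 * L * s) *\<^sub>R apply_bcontfun w s)))"
        by (rule indefinite_integral_continuous_1[OF hint])
    qed (auto intro!: continuous_intros)
    then have "isCont (I w) t" for t :: real
      using continuous_on_interior[of "{..t+1}" "I w" t] by auto
    then show ?thesis by (simp add: continuous_at_imp_continuous_on)
  qed
  have Gb: "G w \<in> bcontfun" for w
  proof (rule bcontfun_normI)
    show "continuous_on UNIV (G w)"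
      unfolding G_def by (intro continuous_intros Icont)
    fix t :: real
    let ?T = "max 0 t"
    have "norm (I w t) \<le> C * (?T - 0)"
      unfolding I_def using integral_bound[of 0 ?T "\<lambda>s. F (exp (2 * L * s) *\<^sub>R apply_bcontfun w s)" C] hcont bd by auto
    also have "C * (?T - 0) \<le> C * (exp (2 * L * ?T) / (2 * L))"
    proof (rule mult_left_mono)
      have "s \<le> exp (2 * L * s) / (2 * L)" for s :: real
      proof -
        have "2 * L * s \<le> exp (2 * L * s)" using exp_ge_add_one_self[of "2 * L * s"] by linarith
        then show ?thesis using L by (simp add: pos_le_divide_eq mult_ac)
      qed
      then show "?T - 0 \<le> exp (2 * L * ?T) / (2 * L)" by simp
    qed (rule C)
    finally have 1: "norm (I w t) \<le> C * (exp (2 * L * ?T) / (2 * L))" .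
    have e1: "exp (2 * L * ?T) \<ge> 1" using L by simp
    have "norm (a0 + I w t) \<le> norm a0 * exp (2 * L * ?T) + C * (exp (2 * L * ?T) / (2 * L))"
      using norm_triangle_ineq[of a0 "I w t"] 1 mult_left_mono[OF e1 norm_ge_zero[of a0]] by linarith
    also have "\<dots> = exp (2 * L * ?T) * (norm a0 + C / (2 * L))" by (simp add: algebra_simps)
    finally have "exp (- (2 * L * ?T)) * norm (a0 + I w t) \<le> exp (- (2 * L * ?T)) * (exp (2 * L * ?T) * (norm a0 + C / (2 * L)))"
      by (rule mult_left_mono) simp
    also have "\<dots> = norm a0 + C / (2 * L)" by (simp add: exp_minus)
    finally show "norm (G w t) \<le> norm a0 + C / (2 * L)" unfolding G_def by simp
  qed
  define \<Phi> where "\<Phi> w = Bcontfun (G w)" for w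
  have \<Phi>: "apply_bcontfun (\<Phi> w) = G w" for w
    unfolding \<Phi>_def using Gb by (simp add: Bcontfun_inverse)
  have contr: "dist (\<Phi> v) (\<Phi> w) \<le> 1/2 * dist v w" for v w
  proof (rule dist_bound)
    fix t :: real
    let ?T = "max 0 t"
    have 2: "((\<lambda>s. L * exp (2 * L * s) * dist v w) has_integral
        (exp (2 * L * ?T) * dist v w / 2 - exp (2 * L * 0) * dist v w / 2)) {0..?T}"
      by (rule fundamental_theorem_of_calculus)
        (auto intro!: derivative_eq_intros simp: has_real_derivative_iff_has_vector_derivative[symmetric])
    have "norm (I v t - I w t) = norm (integral {0..?T} (\<lambda>s. F (exp (2 * L * s) *\<^sub>R apply_bcontfun v s) - F (exp (2 * L * s) *\<^sub>R apply_bcontfun w s)))"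
      unfolding I_def by (simp add: Henstock_Kurzweil_Integration.integral_diff hint)
    also have "\<dots> \<le> integral {0..?T} (\<lambda>s. L * exp (2 * L * s) * dist v w)"
    proof (rule integral_norm_bound_integral)
      fix s assume "s \<in> {0..?T}"
      have "norm (F (exp (2 * L * s) *\<^sub>R apply_bcontfun v s) - F (exp (2 * L * s) *\<^sub>R apply_bcontfun w s))
         \<le> L * norm (exp (2 * L * s) *\<^sub>R (apply_bcontfun v s - apply_bcontfun w s))"
        using lip[of "exp (2 * L * s) *\<^sub>R apply_bcontfun v s" "exp (2 * L * s) *\<^sub>R apply_bcontfun w s"] by (simp add: scaleR_diff_right)
      also have "\<dots> = L * exp (2 * L * s) * dist (apply_bcontfun v s) (apply_bcontfun w s)" by (simp add: dist_norm)
      also have "\<dots> \<le> L * exp (2 * L * s) * dist v w"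
        using L by (intro mult_left_mono dist_bounded) auto
      finally show "norm (F (exp (2 * L * s) *\<^sub>R apply_bcontfun v s) - F (exp (2 * L * s) *\<^sub>R apply_bcontfun w s)) \<le> L * exp (2 * L * s) * dist v w" .
    qed (use 2 in \<open>auto intro!: integrable_diff hint simp: has_integral_integrable\<close>)
    also have "\<dots> = exp (2 * L * ?T) * dist v w / 2 - exp (2 * L * 0) * dist v w / 2"
      using 2 by (rule integral_unique)
    also have "\<dots> \<le> exp (2 * L * ?T) * (1/2 * dist v w)" by simp
    finally have "exp (- (2 * L * ?T)) * norm (I v t - I w t) \<le> exp (- (2 * L * ?T)) * (exp (2 * L * ?T) * (1/2 * dist v w))"
      by (rule mult_left_mono) simp
    also have "\<dots> = 1/2 * dist v w" by (simp add: exp_minus)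
    finally show "dist (apply_bcontfun (\<Phi> v) t) (apply_bcontfun (\<Phi> w) t) \<le> 1/2 * dist v w"
      unfolding \<Phi> G_def dist_norm by (simp flip: scaleR_diff_right)
  qed
  obtain w where w: "\<Phi> w = w"
    using banach_fix_type[of "1/2" \<Phi>] contr by auto
  define g where "g t = exp (2 * L * t) *\<^sub>R apply_bcontfun w t" for t
  have g: "g t = a0 + integral {0..t} (\<lambda>s. F (g s))" if "t \<ge> 0" for t
  proof -
    have "apply_bcontfun w t = G w t" using \<Phi>[of w] w by simp
    then show ?thesis using that unfolding g_def G_def I_def by (simp add: exp_minus)
  qed
  \<comment> \<open>Freezing the field at its time-0 value for negative times and integrating from
    -1 makes \<open>u\<close> differentiable from both sides at 0.\<close>
  define h where "h s = F (g (max 0 s))" for s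
  have hc: "continuous_on S h" for S
    unfolding h_def g_def by (rule continuous_on_compose2[OF Fcont])
      (auto intro!: continuous_intros continuous_on_compose2[OF continuous_on_apply_bcontfun])
  define u where "u t = a0 + (integral {-1..t} h - integral {-1..0} h)" for t
  have ug: "u t = g t" if "t \<ge> 0" for t
  proof -
    have "integral {-1..0} h + integral {0..t} h = integral {-1..t} h"
      using that by (intro Henstock_Kurzweil_Integration.integral_combine integrable_continuous_interval hc) auto
    moreover have "integral {0..t} h = integral {0..t} (\<lambda>s. F (g s))"
      by (rule integral_cong) (auto simp: h_def)
    ultimately show ?thesis using g[OF that] by (simp add: u_def algebra_simps)
  qed
  have "(u has_vector_derivative F (u t)) (at t)" if "t \<ge> 0" for t
  proof -
    have "((\<lambda>t. integral {-1..t} h) has_vector_derivative h t) (at t within {-1..t+1})"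
      using that by (intro integral_has_vector_derivative hc) auto
    moreover have "at t within {-1..t+1} = at t"
      using that by (intro at_within_interior) auto
    ultimately have "(u has_vector_derivative h t) (at t)"
      unfolding u_def by (auto intro!: derivative_eq_intros)
    then show ?thesis using that ug[OF that] by (simp add: h_def)
  qed
  moreover have "u 0 = a0" by (simp add: u_def)
  ultimately show ?thesis by blast
qed

text \<open>The slack \<open>K (g - c)\<close> is harmless because the barrier \<open>c + \<epsilon> e\<^bsup>(K + 1) t\<^esup>\<close> grows faster.\<close>
lemma finite_maximum_principle:
  fixes g g' :: "real \<Rightarrow> 'v::finite \<Rightarrow> real"
  assumes der: "\<And>t x. t \<ge> 0 \<Longrightarrow> ((\<lambda>s. g s x) has_real_derivative g' t x) (at t)"
    and init: "\<And>x. g 0 x \<le> c"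
    and K: "K \<ge> 0" and z: "\<zeta> > 0"
    and step: "\<And>t x. t \<ge> 0 \<Longrightarrow> c < g t x \<Longrightarrow> g t x \<le> c + \<zeta> \<Longrightarrow> (\<And>y. g t y \<le> g t x) \<Longrightarrow> g' t x \<le> K * (g t x - c)"
    and t1: "t1 \<ge> 0"
  shows "g t1 x1 \<le> c"
proof (rule ccontr)
  assume "\<not> g t1 x1 \<le> c"
  then have big: "g t1 x1 > c" by simp
  \<comment> \<open>With this \<open>\<epsilon>\<close> the barrier stays at most
    \<open>c + \<zeta>\<close> up to \<open>t1\<close> and is at most \<open>g t1 x1\<close> there,
    so a contact time exists.\<close>
  define \<epsilon> where "\<epsilon> = min \<zeta> (g t1 x1 - c) / exp ((K + 1) * t1)"
  have e: "\<epsilon> > 0" using z big by (simp add: \<epsilon>_def)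
  define \<beta> where "\<beta> t = c + \<epsilon> * exp ((K + 1) * t)" for t
  have bt: "\<beta> t > c" for t using e by (simp add: \<beta>_def)
  have bmono: "\<beta> s \<le> \<beta> t" if "s \<le> t" for s t
    using e K that by (simp add: \<beta>_def mult_left_mono)
  have b1: "\<beta> t1 \<le> c + \<zeta>" "\<beta> t1 \<le> g t1 x1" by (auto simp: \<beta>_def \<epsilon>_def)
  have bder: "(\<beta> has_real_derivative (K + 1) * (\<beta> t - c)) (at t)" for t
    unfolding \<beta>_def by (auto intro!: derivative_eq_intros)
  have cont: "continuous_on {0..t1} (\<lambda>s. g s x)" for x
    by (rule DERIV_atLeastAtMost_imp_continuous_on) (use der in blast)
  have bcont: "continuous_on {0..t1} \<beta>" unfolding \<beta>_def by (intro continuous_intros)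
  define S where "S = (\<Union>x. {t\<in>{0..t1}. \<beta> t \<le> g t x})"
  have "closed S" unfolding S_def
    by (intro closed_UN finite ballI continuous_closed_preimage_constant continuous_on_closed_Collect_le bcont cont) simp_all
  have ne: "S \<noteq> {}" using b1 t1 by (auto simp: S_def)
  have bb: "bdd_below S" by (rule bdd_belowI[of _ 0]) (auto simp: S_def)
  \<comment> \<open>The first time at which some vertex touches the barrier; the touching vertex
    maximizes \<open>g \<tau>\<close>, so \<open>step\<close> applies to it.\<close>
  define \<tau> where "\<tau> = Inf S"
  have "\<tau> \<in> S" unfolding \<tau>_def using closed_contains_Inf[OF ne bb \<open>closed S\<close>] .
  then obtain x where x: "0 \<le> \<tau>" "\<tau> \<le> t1" "\<beta> \<tau> \<le> g \<tau> x" by (auto simp: S_def)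
  have min: "g s y < \<beta> s" if "0 \<le> s" "s < \<tau>" for s y
  proof (rule ccontr)
    assume "\<not> g s y < \<beta> s"
    then have "s \<in> S" using that x by (auto simp: S_def not_less)
    then show False using cInf_lower[OF _ bb] that unfolding \<tau>_def by force
  qed
  have "\<tau> \<noteq> 0" using init[of x] bt[of 0] x by force
  then have tau: "\<tau> > 0" using x by simp
  have le: "g \<tau> y \<le> \<beta> \<tau>" for y
  proof (rule ccontr)
    assume "\<not> g \<tau> y \<le> \<beta> \<tau>"
    then have pos: "g \<tau> y - \<beta> \<tau> > 0" by simp
    have "isCont (\<lambda>s. g s y - \<beta> s) \<tau>"
      using DERIV_isCont[OF der[OF x(1)]] DERIV_isCont[OF bder] by (intro continuous_intros)
    then have "\<forall>\<^sub>F s in at \<tau>. g s y - \<beta> s > 0"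
      using pos unfolding isCont_def by (rule order_tendstoD(1))
    then have "\<forall>\<^sub>F s in at_left \<tau>. g s y - \<beta> s > 0"
      by (rule filter_leD[OF at_le, rotated]) simp
    moreover have "\<forall>\<^sub>F s in at_left \<tau>. s \<in> {0<..<\<tau>}"
      using eventually_at_left_real[OF tau] .
    ultimately have "\<forall>\<^sub>F s in at_left \<tau>. False"
    proof eventually_elim
      case (elim s)
      then show False using min[of s y] by simp
    qed
    then show False by (simp add: trivial_limit_at_left_real)
  qed
  have eq: "g \<tau> x = \<beta> \<tau>" using le[of x] x by simp
  have "g' \<tau> x \<le> K * (g \<tau> x - c)"
    by (rule step) (use x eq bt[of \<tau>] le bmono[OF x(2)] b1 in auto)
  then have neg: "g' \<tau> x - (K + 1) * (\<beta> \<tau> - c) < 0"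
    using bt[of \<tau>] by (simp add: eq algebra_simps)
  have "((\<lambda>s. g s x - \<beta> s) has_real_derivative g' \<tau> x - (K + 1) * (\<beta> \<tau> - c)) (at \<tau>)"
    by (intro derivative_intros der bder x)
  from DERIV_neg_dec_left[OF this neg] obtain d where d: "d > 0"
    "\<And>h. 0 < h \<Longrightarrow> h < d \<Longrightarrow> g \<tau> x - \<beta> \<tau> < g (\<tau> - h) x - \<beta> (\<tau> - h)" by auto
  define h where "h = min \<tau> d / 2"
  have "0 < h" "h < d" "h < \<tau>" using tau d by (auto simp: h_def)
  then show False using d(2)[of h] min[of "\<tau> - h" x] eq by simp
qed

section \<open>Elementary inequalities\<close>

text \<open>\<open>(1 + s/2) / (1 - s/2)\<close> is a Pade approximant of \<open>exp s\<close>. Its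
  logarithm exceeds \<open>s\<close> by about \<open>s^3/12\<close>, and on [0, 1] the correction
  \<open>s^3/8\<close> dominates this excess.\<close>

lemma exp_ge_pade_cubic:
  fixes s a :: real
  assumes s: "0 \<le> s" "s \<le> 1" and a: "a \<ge> 1 + s\<^sup>2 / 8"
  shows "1 + s / 2 \<le> exp (a * s) * (1 - s / 2)"
proof -
  define \<phi> where "\<phi> z = z + (1/8) * z ^ 3 + ln (1 - (1/2) * z) - ln (1 + (1/2) * z)" for z :: real
  have "\<phi> 0 \<le> \<phi> s"
  proof (rule DERIV_nonneg_imp_nondecreasing[OF s(1)])
    fix z assume z: "0 \<le> z" "z \<le> s"
    have "(\<phi> has_real_derivative 1 + 3 * z\<^sup>2 / 8 + (- 1 / 2) / (1 - z / 2) - (1 / 2) / (1 + z / 2)) (at z)"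
      unfolding \<phi>_def using z s by (auto intro!: derivative_eq_intros)
    moreover have "1 + 3 * z\<^sup>2 / 8 + (- 1 / 2) / (1 - z / 2) - (1 / 2) / (1 + z / 2)
       = z\<^sup>2 * (4 - 3 * z\<^sup>2) / (8 * (4 - z\<^sup>2))"
    proof -
      define y where "y = z\<^sup>2"
      have "y \<le> 1" using z s by (simp add: y_def abs_square_le_1)
      have "(1 / 2) / (1 - z / 2) + (1 / 2) / (1 + z / 2) = 4 / (4 - y)"
        using z s \<open>y \<le> 1\<close> by (simp add: y_def divide_simps) (simp add: power2_eq_square algebra_simps)
      moreover have "1 + 3 * y / 8 - 4 / (4 - y) = y * (4 - 3 * y) / (8 * (4 - y))"
        using \<open>y \<le> 1\<close> by (simp add: divide_simps) (simp add: algebra_simps)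
      ultimately show ?thesis by (simp add: y_def)
    qed
    moreover have "z\<^sup>2 \<le> 1" using z s by (simp add: abs_square_le_1)
    ultimately show "\<exists>y. (\<phi> has_real_derivative y) (at z) \<and> 0 \<le> y" by fastforce
  qed
  then have "ln (1 + s / 2) \<le> s + s ^ 3 / 8 + ln (1 - s / 2)" by (simp add: \<phi>_def)
  also have "s + s ^ 3 / 8 = (1 + s\<^sup>2 / 8) * s" by (simp add: power2_eq_square power3_eq_cube algebra_simps)
  also have "\<dots> \<le> a * s" using a s by (intro mult_right_mono) auto
  finally have "exp (ln (1 + s / 2)) \<le> exp (a * s + ln (1 - s / 2))" by simp
  then show ?thesis using s by (simp add: exp_add)
qed

text \<open>Without the cubic correction the comparison goes the other way; the difference increases
  because \<open>1 - y \<le> exp (- y)\<close>.\<close>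

lemma exp_le_pade:
  fixes z :: real
  assumes z: "0 \<le> z"
  shows "exp z * (1 - z / 2) \<le> 1 + z / 2"
proof -
  define \<phi> where "\<phi> z = 1 + z / 2 - exp z * (1 - z / 2)" for z :: real
  have "\<phi> 0 \<le> \<phi> z"
  proof (rule DERIV_nonneg_imp_nondecreasing[OF z])
    fix y :: real assume y: "0 \<le> y" "y \<le> z"
    have "(\<phi> has_real_derivative 1 / 2 - exp y * (1 - y) / 2) (at y)"
      unfolding \<phi>_def by (auto intro!: derivative_eq_intros simp: field_simps)
    moreover have "exp y * (1 - y) \<le> exp y * exp (- y)"
      using exp_ge_add_one_self[of "- y"] by (intro mult_left_mono) auto
    then have "exp y * (1 - y) \<le> 1" by (simp add: exp_minus)
    ultimately show "\<exists>d. (\<phi> has_real_derivative d) (at y) \<and> 0 \<le> d" by (intro exI conjI) auto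
  qed
  then show ?thesis by (simp add: \<phi>_def)
qed

text \<open>With \<open>s = u y - u x\<close>, this is what the two orientations of an edge
  contribute to the derivative of the mass, up to positive factors. It is \<open>s\<close> times a
  Pade inequality; for negative \<open>s\<close> the endpoints are exchanged.\<close>

lemma edge_supersolution:
  fixes s a :: real
  assumes s: "\<bar>s\<bar> \<le> 1" and a: "a \<ge> 1 + s\<^sup>2 / 8"
  shows "(s + s\<^sup>2 / 2) + exp (a * s) * (- s + s\<^sup>2 / 2) \<le> 0"
proof (cases "s \<ge> 0")
  case True
  then have "s * ((1 + s / 2) - exp (a * s) * (1 - s / 2)) \<le> 0"
    using exp_ge_pade_cubic[of s a] s a by (intro mult_nonneg_nonpos) auto
  then show ?thesis by (simp add: power2_eq_square algebra_simps)
next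
  case False
  define z where "z = - s"
  have "1 + z / 2 \<le> exp (a * z) * (1 - z / 2)"
    using exp_ge_pade_cubic[of z a] s a False by (auto simp: z_def)
  then have "exp (a * s) * (1 + z / 2) \<le> exp (a * s) * (exp (a * z) * (1 - z / 2))"
    by (intro mult_left_mono) auto
  also have "\<dots> = 1 - z / 2" by (simp add: z_def exp_minus)
  finally have "z * (exp (a * s) * (1 + z / 2) - (1 - z / 2)) \<le> 0"
    using False by (intro mult_nonneg_nonpos) (auto simp: z_def)
  then show ?thesis by (simp add: z_def power2_eq_square algebra_simps)
qed

text \<open>The factor \<open>a\<close> on the quadratic terms reverses the sign, by
  \<open>exp_le_pade\<close>. This is the source of the lower bound on the derivative of the
  mass.\<close>

lemma edge_subsolution:
  fixes s a :: real
  assumes a: "a \<ge> 0"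
  shows "0 \<le> (s + a * s\<^sup>2 / 2) + exp (a * s) * (- s + a * s\<^sup>2 / 2)"
proof (cases "s \<ge> 0")
  case True
  then have "0 \<le> s * ((1 + a * s / 2) - exp (a * s) * (1 - a * s / 2))"
    using exp_le_pade[of "a * s"] a by (intro mult_nonneg_nonneg) auto
  then show ?thesis by (simp add: power2_eq_square algebra_simps)
next
  case False
  define z where "z = - s"
  have "exp (a * z) * (1 - a * z / 2) \<le> 1 + a * z / 2"
    using exp_le_pade[of "a * z"] a False by (auto simp: z_def mult_nonneg_nonpos)
  then have "exp (a * s) * (exp (a * z) * (1 - a * z / 2)) \<le> exp (a * s) * (1 + a * z / 2)"
    by (intro mult_left_mono) auto
  moreover have "exp (a * s) * exp (a * z) = 1" by (simp add: z_def exp_minus)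
  then have "exp (a * s) * (exp (a * z) * (1 - a * z / 2)) = 1 - a * z / 2" by (metis mult.assoc mult_1)
  moreover have "z \<ge> 0" using False by (simp add: z_def)
  ultimately have "0 \<le> z * (exp (a * s) * (1 + a * z / 2) - (1 - a * z / 2))"
    by (intro mult_nonneg_nonneg) auto
  then show ?thesis by (simp add: z_def power2_eq_square algebra_simps)
qed

text \<open>The endpoint weights are split into their mean, whose term is nonpositive by
  \<open>edge_supersolution\<close>, and their difference, which alone costs something.\<close>

lemma edge_drift:
  fixes s a p p' l :: real
  assumes s: "\<bar>s\<bar> \<le> 1" and a: "a \<ge> 1 + s\<^sup>2 / 8" and p: "p \<ge> 0" "p' \<ge> 0" "\<bar>p - p'\<bar> \<le> l"
  shows "p * (s + s\<^sup>2 / 2) + p' * exp (a * s) * (- s + s\<^sup>2 / 2) \<le> l / 2 * \<bar>s\<bar> * (1 + exp (a * s))"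
proof -
  define E where "E = exp (a * s)"
  have E: "E > 0" by (simp add: E_def)
  have a0: "a \<ge> 0" using a by (smt (verit) zero_le_power2 divide_nonneg_pos)
  have mono: "s * (1 - E) \<le> 0"
  proof (cases "s \<ge> 0")
    case True
    then have "E \<ge> 1" using a0 by (simp add: E_def)
    then show ?thesis using True by (intro mult_nonneg_nonpos) auto
  next
    case False
    then have "E \<le> 1" using a0 by (simp add: E_def mult_nonneg_nonpos)
    then show ?thesis using False by (intro mult_nonpos_nonneg) auto
  qed
  have abs: "\<bar>s * (1 - E)\<bar> \<le> 1 + E"
  proof -
    have "\<bar>s * (1 - E)\<bar> \<le> 1 * \<bar>1 - E\<bar>" unfolding abs_mult using s by (intro mult_right_mono) auto
    then show ?thesis using E by (auto simp: abs_if split: if_splits)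
  qed
  \<comment> \<open>\<open>s * (1 - E)\<close> is nonpositive and at most \<open>1 + E\<close> in
    modulus, so the expression lies between \<open>(1 + E) / 2\<close> and
    \<open>1 + E\<close>.\<close>
  have br: "\<bar>(1 + E) + s * (1 - E) / 2\<bar> \<le> 1 + E" using mono abs by auto
  have "p * (s + s\<^sup>2 / 2) + p' * E * (- s + s\<^sup>2 / 2) =
     (p + p') / 2 * ((s + s\<^sup>2 / 2) + E * (- s + s\<^sup>2 / 2)) + (p - p') / 2 * (s * ((1 + E) + s * (1 - E) / 2))"
    by (simp add: power2_eq_square field_simps)
  also have "(p + p') / 2 * ((s + s\<^sup>2 / 2) + E * (- s + s\<^sup>2 / 2)) \<le> 0"
    using edge_supersolution[OF s a] p unfolding E_def by (intro mult_nonneg_nonpos) auto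
  also have "(p - p') / 2 * (s * ((1 + E) + s * (1 - E) / 2)) \<le> \<bar>(p - p') / 2\<bar> * (\<bar>s\<bar> * \<bar>(1 + E) + s * (1 - E) / 2\<bar>)"
    by (metis abs_ge_self abs_mult)
  also have "\<dots> \<le> l / 2 * (\<bar>s\<bar> * (1 + E))"
    using p br by (intro mult_mono) auto
  finally show ?thesis by (simp add: E_def mult_ac)
qed

text \<open>The exponent is an upper bound for half the later exponent \<alpha>; the hypothesis
  reduces comparisons of real powers to integer ones.\<close>

lemma powr_9_16_le:
  fixes x y :: real
  assumes "0 < x" "0 < y" "x ^ 9 \<le> y ^ 16"
  shows "x powr (9 / 16) \<le> y"
proof -
  have "x powr (9 / 16) = (x ^ 9) powr (1 / 16)"
    using assms powr_powr[of x 9 "1 / 16"] by simp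
  also have "\<dots> \<le> (y ^ 16) powr (1 / 16)" using assms by (intro powr_mono2) auto
  also have "\<dots> = y" using assms powr_powr[of y 16 "1 / 16"] by simp
  finally show ?thesis .
qed

lemma exp_25_36_ge: "2 \<le> exp (25 / 36 :: real)"
  using ln2_le_25_over_36 ln_le_cancel_iff[of 2 "exp (25 / 36)"] by simp

lemma exp_1_le: "exp 1 \<le> (283 / 100 :: real)"
proof -
  have "exp 2 \<le> exp (3 * ln (2::real))" using ln2_ge_two_thirds by simp
  also have "\<dots> = 8" by (simp add: exp_of_nat_mult[of 3, simplified])
  finally have "(exp 1)\<^sup>2 \<le> (283 / 100 :: real)\<^sup>2" by (simp add: power2_eq_square flip: exp_add)
  then show ?thesis by (rule power2_le_imp_le) simp
qed

text \<open>The argument is \<open>9/8 * (3/2 - 11/25)\<close>, the tail exponent in the extreme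
  case \<open>n = w = 1\<close>, and the left side exceeds \<open>(7/3) / (71/100)\<close>.\<close>

lemma exp_1193_ge: "32865 / 10000 \<le> exp (11925 / 10000 :: real)"
proof -
  have "32865 / 10000 \<le> (1 + 745 / 10000 + (745 / 10000)\<^sup>2 / 2 :: real) ^ 16" by (simp add: power2_eq_square power_divide)
  also have "\<dots> \<le> exp (745 / 10000) ^ 16" by (intro power_mono exp_lower_Taylor_quadratic) auto
  also have "\<dots> = exp (16 * (745 / 10000))" by (simp only: exp_of_nat_mult[of 16, simplified])
  also have "\<dots> \<le> exp (11925 / 10000)" by simp
  finally show ?thesis .
qed

section \<open>Calculus on reversible graphs\<close>

lemma Gamma_one_eq:
  "Gamma_op q (Suc 0) f g x = (\<Sum>y\<in>UNIV. q x y * (f y - f x) * (g y - g x)) / 2"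
proof -
  have "(\<Sum>y\<in>UNIV. q x y * (f y * g y - f x * g x)) - f x * (\<Sum>y\<in>UNIV. q x y * (g y - g x))
      - (\<Sum>y\<in>UNIV. q x y * (f y - f x)) * g x = (\<Sum>y\<in>UNIV. q x y * (f y - f x) * (g y - g x))"
    unfolding sum_distrib_left sum_distrib_right sum_subtractf[symmetric]
    by (intro sum.cong refl) (simp add: algebra_simps)
  then show ?thesis by (simp add: laplacian_def)
qed

declare Gamma_op.simps(2) [simp del]

text \<open>Weights may vanish, so that the locale covers both \<open>m\<close> and its restriction
  to one connected component.\<close>

locale reversible_graph =
  fixes q :: "'v::finite \<Rightarrow> 'v \<Rightarrow> real" and \<mu> :: "'v \<Rightarrow> real"
  assumes q_nonneg: "0 \<le> q x y"
    and \<mu>_nonneg: "0 \<le> \<mu> x"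
    and symm: "\<mu> x * q x y = \<mu> y * q y x"
begin

text \<open>By reversibility \<open>\<mu> x * q x y\<close> is symmetric, so such a sum depends only
  on the symmetrized integrand, and inequalities can be checked edge by edge with both orientations
  added.\<close>

lemma edge_sum_mono:
  assumes "\<And>x y. q x y > 0 \<Longrightarrow> \<phi> x y + \<phi> y x \<le> \<omega> x y + \<omega> y x"
  shows "(\<Sum>x\<in>UNIV. \<mu> x * (\<Sum>y\<in>UNIV. q x y * \<phi> x y)) \<le> (\<Sum>x\<in>UNIV. \<mu> x * (\<Sum>y\<in>UNIV. q x y * \<omega> x y))"
proof -
  have sym: "(\<Sum>x\<in>UNIV. \<mu> x * (\<Sum>y\<in>UNIV. q x y * f x y)) = (\<Sum>x\<in>UNIV. \<Sum>y\<in>UNIV. \<mu> x * q x y * (f x y + f y x)) / 2" for f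
  proof -
    have "(\<Sum>x\<in>UNIV. \<Sum>y\<in>UNIV. \<mu> x * q x y * f y x) = (\<Sum>x\<in>UNIV. \<Sum>y\<in>UNIV. \<mu> x * q x y * f x y)"
      by (subst sum.swap) (simp add: symm)
    then show ?thesis by (simp add: sum_distrib_left[symmetric] distrib_left sum.distrib mult.assoc)
  qed
  show ?thesis unfolding sym
  proof (intro divide_right_mono sum_mono)
    fix x y
    show "\<mu> x * q x y * (\<phi> x y + \<phi> y x) \<le> \<mu> x * q x y * (\<omega> x y + \<omega> y x)"
      using assms[of x y] q_nonneg[of x y] \<mu>_nonneg[of x] by (cases "q x y = 0") (auto intro!: mult_left_mono)
  qed simp
qed

lemma sum_laplacian: "(\<Sum>x\<in>UNIV. \<mu> x * laplacian q f x) = 0"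
proof (rule antisym)
  show "(\<Sum>x\<in>UNIV. \<mu> x * laplacian q f x) \<le> 0"
    using edge_sum_mono[of "\<lambda>x y. f y - f x" "\<lambda>_ _. 0"] by (simp add: laplacian_def)
  show "0 \<le> (\<Sum>x\<in>UNIV. \<mu> x * laplacian q f x)"
    using edge_sum_mono[of "\<lambda>_ _. 0" "\<lambda>x y. f y - f x"] by (simp add: laplacian_def)
qed

text \<open>Discrete integration by parts: both edge integrands symmetrize to
  \<open>- (f y - f x) * (g y - g x)\<close>.\<close>

lemma green: "(\<Sum>x\<in>UNIV. \<mu> x * (f x * laplacian q g x)) = - (\<Sum>x\<in>UNIV. \<mu> x * Gamma_op q (Suc 0) f g x)"
proof -
  have e: "f x * laplacian q g x = (\<Sum>y\<in>UNIV. q x y * (f x * (g y - g x)))" for x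
    by (simp add: laplacian_def sum_distrib_left mult_ac)
  have e': "- Gamma_op q (Suc 0) f g x = (\<Sum>y\<in>UNIV. q x y * (- (f y - f x) * (g y - g x) / 2))" for x
    unfolding Gamma_one_eq sum_divide_distrib sum_negf[symmetric] by (intro sum.cong refl) (simp add: field_simps)
  have "(\<Sum>x\<in>UNIV. \<mu> x * (f x * laplacian q g x)) = (\<Sum>x\<in>UNIV. \<mu> x * - Gamma_op q (Suc 0) f g x)"
    unfolding e e' by (intro antisym edge_sum_mono) (simp_all add: algebra_simps)
  then show ?thesis by (simp add: sum_negf)
qed

end

section \<open>The flow under \<open>CD(0, n)\<close>\<close>

lemma adj_sym: "adj q x y \<longleftrightarrow> adj q y x"
  by (auto simp: adj_def)

locale cd_graph =
  fixes q :: "'v::finite \<Rightarrow> 'v \<Rightarrow> real" and m :: "'v \<Rightarrow> real" and n :: real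
  assumes graph: "finite_graph q"
    and edge: "\<exists>u v. q u v > 0"
    and reversible: "reversible_measure q m"
    and n_pos: "n > 0"
    and cd: "CD q 0 (ereal n)"
begin

abbreviation "\<Delta> \<equiv> laplacian q"
abbreviation "\<Gamma> \<equiv> Gamma_op q (Suc 0)"
abbreviation "D \<equiv> maxdeg q"
abbreviation "Q \<equiv> qmin q"

lemma q_ge_0: "0 \<le> q x y" using graph by (simp add: finite_graph_def)

lemma m_pos: "m x > 0" using reversible by (simp add: reversible_measure_def)

lemma m_nonneg: "m x \<ge> 0" using m_pos less_imp_le by blast

lemma detailed_balance: "m x * q x y = m y * q y x"
  using reversible by (simp add: reversible_measure_def mult.commute)

lemma q_pos_sym: "q x y > 0 \<Longrightarrow> q y x > 0"
  using detailed_balance[of x y] m_pos[of x] m_pos[of y] by (metis mult_pos_pos zero_less_mult_pos)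

lemma adj_iff: "adj q x y \<longleftrightarrow> q x y > 0"
  using q_pos_sym unfolding adj_def by blast

lemma finite_rates: "finite {q x y | x y. 0 < q x y}"
  by (rule finite_subset[of _ "(\<lambda>(x, y). q x y) ` UNIV"]) auto

lemma Q_le: "q x y > 0 \<Longrightarrow> Q \<le> q x y"
  unfolding qmin_def using finite_rates by (intro Min_le) auto

lemma Q_pos: "Q > 0"
proof -
  have "Q \<in> {q x y | x y. 0 < q x y}"
    unfolding qmin_def using edge finite_rates by (intro Min_in) auto
  then show ?thesis by auto
qed

lemma degree_le: "(\<Sum>y\<in>UNIV. q x y) \<le> D"
  unfolding maxdeg_def by (intro Max_ge) auto

lemma q_le_D: "q x y \<le> D"
  using degree_le[of x] member_le_sum[of y UNIV "q x"] q_ge_0 by force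

lemma Q_le_D: "Q \<le> D"
  using edge Q_le q_le_D order_trans by blast

lemma D_pos: "D > 0" using Q_pos Q_le_D by simp

lemma reversible_graph_m: "reversible_graph q m"
  by unfold_locales (simp_all add: q_ge_0 m_nonneg detailed_balance)

lemma Gamma_sym: "\<Gamma> f g x = \<Gamma> g f x"
  unfolding Gamma_one_eq by (simp add: mult_ac)

text \<open>Twice \<open>CD(0, n)\<close>, with the cross term isolated:
  \<open>2 * \<Gamma> f (\<Delta> f)\<close> is what arises when \<open>\<Gamma> u u\<close> is
  differentiated along the flow.\<close>

lemma Bochner: "\<Delta> (\<Gamma> f f) x - 2 * \<Gamma> f (\<Delta> f) x \<ge> 2 / n * (\<Delta> f x)\<^sup>2"
proof -
  have "Gamma_op q 2 f f x \<ge> 1 / n * (\<Delta> f x)\<^sup>2"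
    using cd n_pos unfolding CD_def by (auto simp: inverse_eq_divide)
  moreover have "2 * Gamma_op q (Suc (Suc 0)) f f x = \<Delta> (\<Gamma> f f) x - \<Gamma> f (\<Delta> f) x - \<Gamma> (\<Delta> f) f x"
    by (simp add: Gamma_op.simps(2)[of q "Suc 0"])
  ultimately show ?thesis using Gamma_sym[of "\<Delta> f" f] by (simp add: numeral_2_eq_2)
qed

lemma Gamma_nonneg: "\<Gamma> f f x \<ge> 0"
  unfolding Gamma_one_eq using q_ge_0 by (auto intro!: sum_nonneg simp: mult.assoc)

lemma Gamma_ge_edge: "q x y / 2 * (f y - f x)\<^sup>2 \<le> \<Gamma> f f x"
proof -
  have "q x y * (f y - f x) * (f y - f x) \<le> (\<Sum>y\<in>UNIV. q x y * (f y - f x) * (f y - f x))"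
    using q_ge_0 by (intro member_le_sum) (auto simp: mult.assoc)
  then show ?thesis unfolding Gamma_one_eq by (simp add: power2_eq_square)
qed

lemma Gamma_edge_bound:
  assumes "q x y > 0"
  shows "Q / 2 * (f y - f x)\<^sup>2 \<le> \<Gamma> f f x"
  using Gamma_ge_edge[of x y f] mult_right_mono[OF Q_le[OF assms], of "(f y - f x)\<^sup>2 / 2"] by simp

text \<open>Integrating the curvature condition against \<open>m\<close> turns \<open>\<Gamma>\<^sub>2\<close> into the square of the Laplacian.\<close>
lemma dimension_ge_1: "n \<ge> 1"
proof -
  interpret R: reversible_graph q m by (rule reversible_graph_m)
  obtain u v where uv: "q u v > 0" using edge by blast
  have ne: "u \<noteq> v" using uv graph by (auto simp: finite_graph_def)
  \<comment> \<open>The indicator of \<open>v\<close> has nonzero Laplacian at its neighbour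
    \<open>u\<close>, so \<open>S\<close> is positive.\<close>
  define f where "f y = (if y = v then 1 else 0 :: real)" for y
  have "\<Delta> f u = (\<Sum>y\<in>UNIV. if y = v then q u v else 0)"
    unfolding laplacian_def f_def by (intro sum.cong refl) (use ne in auto)
  then have du: "\<Delta> f u = q u v" by simp
  define S where "S = (\<Sum>x\<in>UNIV. m x * (\<Delta> f x)\<^sup>2)"
  have "S > 0" unfolding S_def
  proof (rule sum_pos2)
    show "0 < m u * (\<Delta> f u)\<^sup>2" using m_pos[of u] uv du by simp
  qed (simp_all add: m_nonneg)
  have "2 / n * S = (\<Sum>x\<in>UNIV. m x * (2 / n * (\<Delta> f x)\<^sup>2))"
    unfolding S_def sum_distrib_left by (simp add: mult_ac)
  also have "\<dots> \<le> (\<Sum>x\<in>UNIV. m x * (\<Delta> (\<Gamma> f f) x - 2 * \<Gamma> f (\<Delta> f) x))"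
    by (intro sum_mono mult_left_mono Bochner) (simp_all add: m_nonneg)
  also have "\<dots> = - 2 * (\<Sum>x\<in>UNIV. m x * \<Gamma> (\<Delta> f) f x)"
    using R.sum_laplacian[of "\<Gamma> f f"] Gamma_sym[of f "\<Delta> f"]
    by (simp add: right_diff_distrib sum_subtractf sum_distrib_left mult_ac sum_negf)
  also have "\<dots> = 2 * S"
    using R.green[of "\<Delta> f" f] by (simp add: S_def power2_eq_square)
  finally have "1 / n * S \<le> 1 * S" by simp
  then have "1 / n \<le> 1" using \<open>S > 0\<close> by (simp only: mult_le_cancel_right_pos)
  then show ?thesis using n_pos by (simp add: field_simps)
qed

text \<open>Truncating the increments makes the vector field bounded and Lipschitz; the gradient bound below shows
  that the truncation never acts.\<close>
lemma truncated_flow_exists: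
  "\<exists>U. U 0 = u0 \<and> (\<forall>t\<ge>0. \<forall>x. ((\<lambda>s. U s x) has_real_derivative
      (\<Sum>y\<in>UNIV. q x y * (max (- 2) (min 2 (U t y - U t x)) + (max (- 2) (min 2 (U t y - U t x)))\<^sup>2 / 2))) (at t))"
proof -
  \<comment> \<open>Clamping leaves \<open>s + s^2/2\<close> unchanged for increments of modulus at
    most 2, and makes it bounded by 4 and Lipschitz with constant 3.\<close>
  define p where "p s = max (- 2) (min 2 s) + (max (- 2) (min 2 s))\<^sup>2 / 2" for s :: real
  define F where "F a = (\<chi> x. \<Sum>y\<in>UNIV. q x y * p (a $ y - a $ x))" for a :: "real ^ 'v"
  have pbd: "\<bar>p s\<bar> \<le> 4" for s
  proof -
    define a where "a = max (- 2) (min 2 s)"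
    have a: "- 2 \<le> a" "a \<le> 2" by (auto simp: a_def)
    then have "a\<^sup>2 \<le> 2\<^sup>2" by (intro power2_le_iff_abs_le[THEN iffD2]) auto
    then have "a\<^sup>2 \<le> 4" by simp
    moreover have "p s = a + a\<^sup>2 / 2" by (simp add: p_def a_def)
    moreover have "0 \<le> a\<^sup>2" by simp
    ultimately show ?thesis using a unfolding abs_le_iff by linarith
  qed
  have plip: "\<bar>p s - p t\<bar> \<le> 3 * \<bar>s - t\<bar>" for s t
  proof -
    define a b where "a = max (- 2) (min 2 s)" and "b = max (- 2) (min 2 t)"
    have "\<bar>a - b\<bar> \<le> \<bar>s - t\<bar>" "\<bar>a\<bar> \<le> 2" "\<bar>b\<bar> \<le> 2" unfolding a_def b_def by auto
    moreover have "p s - p t = (a - b) * (1 + (a + b) / 2)"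
      unfolding p_def a_def[symmetric] b_def[symmetric] by (simp add: power2_eq_square field_simps)
    moreover have "\<bar>1 + (a + b) / 2\<bar> \<le> 3" using \<open>\<bar>a\<bar> \<le> 2\<close> \<open>\<bar>b\<bar> \<le> 2\<close> unfolding abs_le_iff by (auto simp: add_divide_distrib)
    ultimately have "\<bar>p s - p t\<bar> \<le> \<bar>s - t\<bar> * 3" unfolding \<open>p s - p t = _\<close> abs_mult by (intro mult_mono) auto
    then show ?thesis by simp
  qed
  \<comment> \<open>The 6 is the Lipschitz constant 3 times two moving endpoints; the summand 1
    keeps \<open>L\<close> positive.\<close>
  define L where "L = (\<Sum>x\<in>UNIV. \<Sum>y\<in>UNIV. q x y * 6) + 1"
  define C where "C = (\<Sum>x\<in>UNIV. \<Sum>y\<in>UNIV. q x y * 4)"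
  have "\<exists>u. u 0 = (\<chi> x. u0 x) \<and> (\<forall>t\<ge>0. (u has_vector_derivative F (u t)) (at t))"
  proof (rule lipschitz_bounded_ode_solution)
    show "norm (F a) \<le> C" for a
    proof -
      have "norm (F a) \<le> (\<Sum>x\<in>UNIV. \<bar>F a $ x\<bar>)" by (rule norm_le_l1_cart)
      also have "\<dots> \<le> C" unfolding C_def F_def vec_lambda_beta
        by (intro sum_mono order_trans[OF sum_abs]) (simp add: abs_mult q_ge_0 mult_left_mono pbd)
      finally show ?thesis .
    qed
    show "norm (F a - F b) \<le> L * norm (a - b)" for a b
    proof -
      have c: "\<bar>a $ x - b $ x\<bar> \<le> norm (a - b)" for x
        using component_le_norm_cart[of "a - b" x] by simp
      have "norm (F a - F b) \<le> (\<Sum>x\<in>UNIV. \<bar>(F a - F b) $ x\<bar>)" by (rule norm_le_l1_cart)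
      also have "\<dots> \<le> (\<Sum>x\<in>UNIV. \<Sum>y\<in>UNIV. q x y * 6 * norm (a - b))"
      proof (rule sum_mono)
        fix x
        have "\<bar>(F a - F b) $ x\<bar> = \<bar>\<Sum>y\<in>UNIV. q x y * (p (a $ y - a $ x) - p (b $ y - b $ x))\<bar>"
          by (simp add: F_def right_diff_distrib sum_subtractf)
        also have "\<dots> \<le> (\<Sum>y\<in>UNIV. \<bar>q x y * (p (a $ y - a $ x) - p (b $ y - b $ x))\<bar>)" by (rule sum_abs)
        also have "\<dots> \<le> (\<Sum>y\<in>UNIV. q x y * 6 * norm (a - b))"
        proof (rule sum_mono)
          fix y
          have "\<bar>p (a $ y - a $ x) - p (b $ y - b $ x)\<bar> \<le> 3 * \<bar>(a $ y - a $ x) - (b $ y - b $ x)\<bar>"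
            by (rule plip)
          also have "\<dots> \<le> 3 * (norm (a - b) + norm (a - b))"
            using c[of x] c[of y] by (intro mult_left_mono) linarith+
          also have "\<dots> = 6 * norm (a - b)" by simp
          finally show "\<bar>q x y * (p (a $ y - a $ x) - p (b $ y - b $ x))\<bar> \<le> q x y * 6 * norm (a - b)"
            unfolding abs_mult using q_ge_0[of x y] mult_left_mono[of _ "6 * norm (a - b)" "q x y"]
            by (simp add: mult.assoc)
        qed
        finally show "\<bar>(F a - F b) $ x\<bar> \<le> (\<Sum>y\<in>UNIV. q x y * 6 * norm (a - b))" .
      qed
      also have "\<dots> \<le> L * norm (a - b)"
        by (simp add: L_def sum_distrib_right distrib_right)
      finally show ?thesis .
    qed
    show "L > 0" unfolding L_def using q_ge_0 by (intro add_nonneg_pos sum_nonneg) auto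
  qed
  then obtain u where u0: "u 0 = (\<chi> x. u0 x)"
    and u: "\<And>t. t \<ge> 0 \<Longrightarrow> (u has_vector_derivative F (u t)) (at t)" by blast
  have "((\<lambda>s. u s $ x) has_real_derivative F (u t) $ x) (at t)" if "t \<ge> 0" for t x
    using bounded_linear.has_vector_derivative[OF bounded_linear_vec_nth u[OF that]]
    by (simp add: has_real_derivative_iff_has_vector_derivative)
  then show ?thesis
    using u0 by (intro exI[of _ "\<lambda>t x. u t $ x"]) (auto simp: F_def p_def)
qed

lemma flow_identity: "(\<Sum>y\<in>UNIV. q x y * ((f y - f x) + (f y - f x)\<^sup>2 / 2)) = \<Delta> f x + \<Gamma> f f x"
  unfolding Gamma_one_eq laplacian_def sum_divide_distrib
  by (simp add: distrib_left sum.distrib power2_eq_square mult_ac)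

text \<open>The left side is the linearization of \<open>\<Delta> u + \<Gamma> u u\<close> at
  \<open>f\<close> in direction \<open>g\<close>; it obeys a maximum principle wherever the edge
  weights \<open>1 + (f y - f x)\<close> are nonnegative.\<close>

lemma drift_laplacian: "\<Delta> g x + 2 * \<Gamma> f g x = (\<Sum>y\<in>UNIV. q x y * ((1 + (f y - f x)) * (g y - g x)))"
  unfolding Gamma_one_eq laplacian_def by (simp add: distrib_left distrib_right sum.distrib mult_ac)

lemma Gamma_add: "\<Gamma> f (\<lambda>y. g y + h y) x = \<Gamma> f g x + \<Gamma> f h x"
  unfolding Gamma_one_eq
  by (simp add: add_divide_distrib[symmetric] sum.distrib[symmetric] algebra_simps)

lemma laplacian_add: "\<Delta> (\<lambda>y. g y + h y) x = \<Delta> g x + \<Delta> h x"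
  unfolding laplacian_def by (simp add: sum.distrib[symmetric] algebra_simps)

lemma laplacian_has_derivative:
  assumes "\<And>y. ((\<lambda>s. g s y) has_real_derivative g' y) (at t)"
  shows "((\<lambda>s. \<Delta> (g s) x) has_real_derivative \<Delta> g' x) (at t)"
  unfolding laplacian_def by (rule derivative_eq_intros refl assms)+ (simp add: mult.commute)

text \<open>For \<open>n = 1\<close> the coefficient \<open>1 + u(y) - u(x)\<close> may turn slightly negative as soon as the bound is exceeded,
  which is why the maximum principle is needed with its slack term.\<close>
lemma gradient_preserving_flow_exists:
  assumes init: "\<And>x. \<Gamma> u0 u0 x \<le> Q / (2 * n)"
  shows "\<exists>U. U 0 = u0 \<and> (\<forall>t\<ge>0. \<forall>x. ((\<lambda>s. U s x) has_real_derivative \<Delta> (U t) x + \<Gamma> (U t) (U t) x) (at t))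
     \<and> (\<forall>t\<ge>0. \<forall>x. \<Gamma> (U t) (U t) x \<le> Q / (2 * n))"
proof -
  define V where "V W x = (\<Sum>y\<in>UNIV. q x y * (max (- 2) (min 2 (W y - W x)) + (max (- 2) (min 2 (W y - W x)))\<^sup>2 / 2))" for W :: "'v \<Rightarrow> real" and x
  obtain U where U0: "U 0 = u0"
    and U: "\<And>t x. t \<ge> 0 \<Longrightarrow> ((\<lambda>s. U s x) has_real_derivative V (U t) x) (at t)"
    using truncated_flow_exists[of u0] unfolding V_def by blast
  define c where "c = Q / (2 * n)"
  have c: "0 < c" "c \<le> Q / 2" using Q_pos n_pos dimension_ge_1 by (simp_all add: c_def field_simps)
  have V: "V W x = \<Delta> W x + \<Gamma> W W x" if "\<And>y z. q y z > 0 \<Longrightarrow> \<bar>W z - W y\<bar> \<le> 2" for W x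
  proof -
    have "V W x = (\<Sum>y\<in>UNIV. q x y * ((W y - W x) + (W y - W x)\<^sup>2 / 2))"
      unfolding V_def
    proof (intro sum.cong refl)
      fix y
      show "q x y * (max (- 2) (min 2 (W y - W x)) + (max (- 2) (min 2 (W y - W x)))\<^sup>2 / 2) =
        q x y * ((W y - W x) + (W y - W x)\<^sup>2 / 2)"
      proof (cases "q x y > 0")
        case True
        then have "max (- 2) (min 2 (W y - W x)) = W y - W x" using that[of x y] by auto
        then show ?thesis by simp
      next
        case False
        then have "q x y = 0" using q_ge_0[of x y] by simp
        then show ?thesis by simp
      qed
    qed
    then show ?thesis unfolding flow_identity .
  qed
  \<comment> \<open>An excess \<open>e\<close> over \<open>c\<close> lets the edge increments exceed
    1 by at most \<open>e / Q\<close>; for \<open>e \<le> Q\<close> the truncation therefore stays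
    inactive.\<close>
  have gr: "\<bar>W z - W y\<bar> \<le> 1 + e / Q" if W: "\<Gamma> W W y \<le> c + e" "e \<ge> 0" and e: "q y z > 0" for W y z e
  proof -
    have "Q / 2 * (W z - W y)\<^sup>2 \<le> Q / 2 + e"
      using Gamma_edge_bound[OF e, of W] W c by linarith
    then have "(W z - W y)\<^sup>2 \<le> 1 + 2 * (e / Q)" using Q_pos by (simp add: field_simps)
    also have "\<dots> \<le> (1 + e / Q)\<^sup>2" by (simp add: power2_eq_square algebra_simps)
    finally have "\<bar>W z - W y\<bar> \<le> \<bar>1 + e / Q\<bar>" by (simp add: abs_le_square_iff)
    then show ?thesis using W Q_pos by simp
  qed
  \<comment> \<open>\<open>\<zeta> = Q\<close> keeps the increments at most 2, and \<open>K\<close>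
    absorbs the loss \<open>D * (e / Q) * (c + Q)\<close> caused by slightly negative drift
    weights.\<close>
  have bound: "\<Gamma> (U t) (U t) x \<le> c" if "t \<ge> 0" for t x
  proof (rule finite_maximum_principle[where g = "\<lambda>t. \<Gamma> (U t) (U t)" and g' = "\<lambda>t. \<Gamma> (\<lambda>y. 2 * U t y) (V (U t))"
        and \<zeta> = Q and K = "D * (c + Q) / Q"])
    show "((\<lambda>s. \<Gamma> (U s) (U s) x) has_real_derivative \<Gamma> (\<lambda>y. 2 * U t y) (V (U t)) x) (at t)" if "t \<ge> 0" for t x
      unfolding Gamma_one_eq
      by (rule derivative_eq_intros refl U that)+
        (auto intro!: sum.cong simp: sum_divide_distrib algebra_simps)
    show "0 \<le> D * (c + Q) / Q" using D_pos Q_pos c by auto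
    fix t x assume t: "t \<ge> 0" and x: "c < \<Gamma> (U t) (U t) x" "\<Gamma> (U t) (U t) x \<le> c + Q"
      "\<And>y. \<Gamma> (U t) (U t) y \<le> \<Gamma> (U t) (U t) x"
    define W where "W = U t"
    define e where "e = \<Gamma> W W x - c"
    have e: "0 \<le> e" "e \<le> Q" using x by (auto simp: e_def W_def)
    have s: "\<bar>W z - W y\<bar> \<le> 1 + e / Q" if "q y z > 0" for y z
      by (rule gr) (use x(3)[of y] e that in \<open>auto simp: e_def W_def\<close>)
    have "1 + e / Q \<le> 2" using e Q_pos by simp
    then have VW: "V W = (\<lambda>x. \<Delta> W x + \<Gamma> W W x)"
      using V s order_trans by blast
    have "\<Gamma> (\<lambda>y. 2 * W y) (V W) x = 2 * \<Gamma> W (V W) x"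
      unfolding Gamma_one_eq sum_divide_distrib sum_distrib_left by (intro sum.cong refl) (simp add: algebra_simps)
    also have "\<dots> = 2 * \<Gamma> W (\<Delta> W) x + 2 * \<Gamma> W (\<Gamma> W W) x"
      unfolding VW by (simp only: Gamma_add distrib_left)
    also have "\<dots> \<le> \<Delta> (\<Gamma> W W) x + 2 * \<Gamma> W (\<Gamma> W W) x"
    proof -
      have "0 \<le> 2 / n * (\<Delta> W x)\<^sup>2" using n_pos by simp
      then show ?thesis using Bochner[of W x] by linarith
    qed
    also have "\<dots> = (\<Sum>y\<in>UNIV. q x y * ((1 + (W y - W x)) * (\<Gamma> W W y - \<Gamma> W W x)))"
      by (rule drift_laplacian)
    also have "\<dots> \<le> (\<Sum>y\<in>UNIV. q x y * (e / Q * (c + Q)))"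
    proof (rule sum_mono)
      fix y
      show "q x y * ((1 + (W y - W x)) * (\<Gamma> W W y - \<Gamma> W W x)) \<le> q x y * (e / Q * (c + Q))"
      proof (cases "q x y > 0")
        case True
        define v where "v = \<Gamma> W W x - \<Gamma> W W y"
        have v: "0 \<le> v" "v \<le> c + Q" using x Gamma_nonneg[of W y] by (auto simp: v_def W_def)
        have "- (1 + (W y - W x)) * v \<le> (e / Q) * v"
          using s[OF True] v by (intro mult_right_mono) auto
        also have "\<dots> \<le> e / Q * (c + Q)" using v e Q_pos by (intro mult_left_mono) auto
        finally have "(1 + (W y - W x)) * (\<Gamma> W W y - \<Gamma> W W x) \<le> e / Q * (c + Q)"
          by (simp add: v_def algebra_simps)
        then show ?thesis using q_ge_0 by (intro mult_left_mono)
      next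
        case False
        then have "q x y = 0" using q_ge_0[of x y] by simp
        then show ?thesis by simp
      qed
    qed
    also have "\<dots> \<le> D * (e / Q * (c + Q))"
      unfolding sum_distrib_right[symmetric] using degree_le e c Q_pos by (intro mult_right_mono) auto
    finally show "\<Gamma> (\<lambda>y. 2 * U t y) (V (U t)) x \<le> D * (c + Q) / Q * (\<Gamma> (U t) (U t) x - c)"
      by (simp add: W_def e_def mult_ac)
  qed (use Q_pos init U0 that in \<open>auto simp: c_def\<close>)
  have "V (U t) x = \<Delta> (U t) x + \<Gamma> (U t) (U t) x" if "t \<ge> 0" for t x
  proof (rule V)
    fix y z assume "q y z > 0"
    then show "\<bar>U t z - U t y\<bar> \<le> 2" using gr[of "U t" y 0 z] bound[OF that] by simp
  qed
  then show ?thesis using U U0 bound unfolding c_def by (intro exI[of _ U]) auto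
qed

text \<open>Li--Yau: \<open>v = - \<Delta> u\<close> satisfies \<open>v' \<le> L v - 2/n v\<^sup>2\<close> with an operator \<open>L\<close> obeying the maximum principle,
  because \<open>1 + u(y) - u(x) \<ge> 0\<close> across edges.\<close>
lemma Li_Yau_flow_exists:
  assumes init: "\<And>x. \<Gamma> u0 u0 x \<le> Q / (2 * n)" "\<And>x. \<Delta> u0 x \<ge> - n / (2 * t0)" and t0: "t0 > 0"
  shows "\<exists>U. U 0 = u0 \<and> (\<forall>t\<ge>0. \<forall>x. ((\<lambda>s. U s x) has_real_derivative \<Delta> (U t) x + \<Gamma> (U t) (U t) x) (at t))
     \<and> (\<forall>t\<ge>0. \<forall>x y. q x y > 0 \<longrightarrow> (U t y - U t x)\<^sup>2 \<le> 1 / n)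
     \<and> (\<forall>t\<ge>0. \<forall>x. \<Delta> (U t) x \<ge> - n / (2 * (t + t0)))"
proof -
  obtain U where U0: "U 0 = u0"
    and U: "\<And>t x. t \<ge> 0 \<Longrightarrow> ((\<lambda>s. U s x) has_real_derivative \<Delta> (U t) x + \<Gamma> (U t) (U t) x) (at t)"
    and UG: "\<And>t x. t \<ge> 0 \<Longrightarrow> \<Gamma> (U t) (U t) x \<le> Q / (2 * n)"
    using gradient_preserving_flow_exists[OF init(1)] by blast
  have grad: "(U t y - U t x)\<^sup>2 \<le> 1 / n" if "t \<ge> 0" "q x y > 0" for t x y
  proof -
    have "Q / 2 * (U t y - U t x)\<^sup>2 \<le> Q / 2 * (1 / n)"
      using Gamma_edge_bound[OF that(2), of "U t"] UG[OF that(1), of x] by (simp add: mult.commute)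
    then show ?thesis using Q_pos by (simp only: mult_le_cancel_left_pos half_gt_zero)
  qed
  have grad1: "\<bar>U t y - U t x\<bar> \<le> 1" if "t \<ge> 0" "q x y > 0" for t x y
  proof -
    have "(U t y - U t x)\<^sup>2 \<le> 1" using grad[OF that] dimension_ge_1 by (simp add: order_trans)
    then show ?thesis by (simp add: abs_square_le_1)
  qed
  \<comment> \<open>Multiplying \<open>- \<Delta> u\<close> by the shifted time turns the bound into
    a constant barrier, to which the maximum principle applies with \<open>K = 0\<close>.\<close>
  have LY: "(t + t0) * - \<Delta> (U t) x \<le> n / 2" if "t \<ge> 0" for t x
  proof (rule finite_maximum_principle[where g = "\<lambda>t x. (t + t0) * - \<Delta> (U t) x"
        and g' = "\<lambda>t x. - \<Delta> (U t) x - (t + t0) * \<Delta> (\<lambda>y. \<Delta> (U t) y + \<Gamma> (U t) (U t) y) x" and \<zeta> = 1 and K = 0])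
    show "((\<lambda>s. (s + t0) * - \<Delta> (U s) x) has_real_derivative
       - \<Delta> (U t) x - (t + t0) * \<Delta> (\<lambda>y. \<Delta> (U t) y + \<Gamma> (U t) (U t) y) x) (at t)" if "t \<ge> 0" for t x
    proof -
      have "((\<lambda>s. \<Delta> (U s) x) has_real_derivative \<Delta> (\<lambda>y. \<Delta> (U t) y + \<Gamma> (U t) (U t) y) x) (at t)"
        by (rule laplacian_has_derivative[OF U[OF that]])
      then show ?thesis by (auto intro!: derivative_eq_intros)
    qed
    show "(0 + t0) * - \<Delta> (U 0) x \<le> n / 2" for x
      using init(2)[of x] t0 by (simp add: U0 field_simps)
    fix t x assume t: "t \<ge> 0" and x: "n / 2 < (t + t0) * - \<Delta> (U t) x"
      and mx: "\<And>y. (t + t0) * - \<Delta> (U t) y \<le> (t + t0) * - \<Delta> (U t) x"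
    define W where "W = U t"
    define G where "G = - \<Delta> W x"
    have \<tau>: "t + t0 > 0" using t t0 by simp
    have "\<Delta> W x \<le> \<Delta> W y" for y using mx[of y] \<tau> by (simp add: W_def)
    then have "0 \<le> (\<Sum>y\<in>UNIV. q x y * ((1 + (W y - W x)) * (\<Delta> W y - \<Delta> W x)))"
    proof (intro sum_nonneg)
      fix y assume le: "\<And>y. \<Delta> W x \<le> \<Delta> W y"
      show "0 \<le> q x y * ((1 + (W y - W x)) * (\<Delta> W y - \<Delta> W x))"
        using grad1[OF t, of x y] le[of y] q_ge_0[of x y]
        by (cases "q x y > 0") (auto intro!: mult_nonneg_nonneg simp: W_def)
    qed
    also have "\<dots> = \<Delta> (\<Delta> W) x + 2 * \<Gamma> W (\<Delta> W) x" by (rule drift_laplacian[symmetric])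
    also have "\<dots> \<le> \<Delta> (\<Delta> W) x + \<Delta> (\<Gamma> W W) x - 2 / n * (\<Delta> W x)\<^sup>2"
      using Bochner[of W x] by linarith
    also have "\<dots> = \<Delta> (\<lambda>y. \<Delta> W y + \<Gamma> W W y) x - 2 / n * G\<^sup>2"
      by (simp add: laplacian_add G_def)
    finally have 1: "2 / n * G\<^sup>2 \<le> \<Delta> (\<lambda>y. \<Delta> W y + \<Gamma> W W y) x" by simp
    have G: "n / 2 < (t + t0) * G" using x by (simp add: G_def W_def)
    then have "0 < (t + t0) * G" using n_pos by simp
    then have G0: "G > 0" using \<tau> zero_less_mult_pos by blast
    \<comment> \<open>Above the barrier the quadratic Bochner term outweighs the \<open>G\<close>
      produced by differentiating the factor \<open>t + t0\<close>.\<close>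
    have "G = 2 / n * (n / 2) * G" using n_pos by simp
    also have "\<dots> \<le> 2 / n * ((t + t0) * G) * G" using G G0 n_pos by (intro mult_right_mono mult_left_mono) auto
    also have "\<dots> = (t + t0) * (2 / n * G\<^sup>2)" by (simp add: power2_eq_square)
    also have "\<dots> \<le> (t + t0) * \<Delta> (\<lambda>y. \<Delta> W y + \<Gamma> W W y) x" using 1 \<tau> by (intro mult_left_mono) auto
    finally show "- \<Delta> (U t) x - (t + t0) * \<Delta> (\<lambda>y. \<Delta> (U t) y + \<Gamma> (U t) (U t) y) x \<le> 0 * ((t + t0) * - \<Delta> (U t) x - n / 2)"
      by (simp add: G_def W_def)
  qed (use that in auto)
  have "\<Delta> (U t) x \<ge> - n / (2 * (t + t0))" if "t \<ge> 0" for t x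
    using LY[OF that, of x] that t0 by (simp add: field_simps)
  then show ?thesis using U U0 grad by (intro exI[of _ U]) auto
qed

end

section \<open>Harnack inequality and mass transport along the flow\<close>

text \<open>The shift \<open>t0\<close> lets the Li--Yau bound hold from time 0 on, as if the flow
  had started at \<open>- t0\<close>. The separate weight allows masses to be taken over a single
  component.\<close>

locale li_yau_flow = cd_graph q m n
  for q :: "'v::finite \<Rightarrow> 'v \<Rightarrow> real" and m :: "'v \<Rightarrow> real" and n :: real +
  fixes U :: "real \<Rightarrow> 'v \<Rightarrow> real" and t0 :: real and \<mu> :: "'v \<Rightarrow> real"
  assumes t0_pos: "t0 > 0"
    and flow: "t \<ge> 0 \<Longrightarrow> ((\<lambda>s. U s x) has_real_derivative laplacian q (U t) x + Gamma_op q (Suc 0) (U t) (U t) x) (at t)"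
    and edge_gradient: "t \<ge> 0 \<Longrightarrow> q x y > 0 \<Longrightarrow> (U t y - U t x)\<^sup>2 \<le> 1 / n"
    and Li_Yau: "t \<ge> 0 \<Longrightarrow> laplacian q (U t) x \<ge> - n / (2 * (t + t0))"
    and weight_nonneg: "\<mu> x \<ge> 0"
    and weight_nontrivial: "\<exists>x. \<mu> x > 0"
    and weight_balance: "\<mu> x * q x y = \<mu> y * q y x"
begin

sublocale W: reversible_graph q \<mu>
  by unfold_locales (simp_all add: q_ge_0 weight_nonneg weight_balance)

section \<open>Parabolic Harnack inequality\<close>

definition "v t x = U t x + n / 2 * ln (t + t0)"

lemma v_deriv:
  assumes "t \<ge> 0"
  shows "((\<lambda>s. v s x) has_real_derivative \<Delta> (U t) x + \<Gamma> (U t) (U t) x + n / (2 * (t + t0))) (at t)"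
proof -
  have "((\<lambda>s. ln (s + t0)) has_real_derivative 1 / (t + t0)) (at t)"
    using assms t0_pos by (auto intro!: derivative_eq_intros)
  from DERIV_add[OF flow[OF assms, of x] DERIV_cmult[OF this, of "n / 2"]]
  show ?thesis unfolding v_def by simp
qed

lemma v_deriv_ge: "t \<ge> 0 \<Longrightarrow> \<Gamma> (U t) (U t) x \<le> \<Delta> (U t) x + \<Gamma> (U t) (U t) x + n / (2 * (t + t0))"
  using Li_Yau[of t x] by simp

text \<open>The logarithm in \<open>v\<close> compensates exactly the decrease that Li--Yau allows,
  so the derivative of \<open>v\<close> is at least \<open>\<Gamma> u u\<close>.\<close>

lemma v_mono:
  assumes "0 \<le> s" "s \<le> t"
  shows "v s x \<le> v t x"
proof (rule DERIV_nonneg_imp_nondecreasing[OF assms(2)])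
  fix r assume "s \<le> r" "r \<le> t"
  then have r: "r \<ge> 0" using assms by simp
  show "\<exists>y. ((\<lambda>t. v t x) has_real_derivative y) (at r) \<and> 0 \<le> y"
    using v_deriv[OF r] v_deriv_ge[OF r] Gamma_nonneg order_trans by blast
qed

text \<open>If \<open>v\<close> at \<open>z\<close> stays above \<open>p\<close>, then \<open>v\<close> at \<open>y\<close> satisfies the Riccati inequality \<open>v' \<ge> Q/2 (p - v)\<^sup>2\<close>.\<close>
lemma Harnack_edge:
  assumes "adj q z y" "0 \<le> a" "h > 0"
  shows "v a z - 2 / (Q * h) \<le> v (a + h) y"
proof (rule ccontr)
  assume neg: "\<not> ?thesis"
  define p where "p = v a z"
  have Qh: "Q * h > 0" using Q_pos assms by simp
  have "0 < 2 / (Q * h)" using Qh by simp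
  have qyz: "q y z > 0" using assms adj_sym adj_iff by blast
  have below: "v s y < p" if "a \<le> s" "s \<le> a + h" for s
  proof -
    have "v s y \<le> v (a + h) y" using that assms by (intro v_mono) auto
    also have "\<dots> < p" using neg \<open>0 < 2 / (Q * h)\<close> unfolding p_def by linarith
    finally show ?thesis .
  qed
  \<comment> \<open>Integrated form of the Riccati inequality: \<open>1 / (p - v)\<close> grows at
    rate at least \<open>Q / 2\<close>.\<close>
  have "1 / (p - v a y) - Q / 2 * a \<le> 1 / (p - v (a + h) y) - Q / 2 * (a + h)"
  proof (rule DERIV_nonneg_imp_nondecreasing[where f = "\<lambda>s. 1 / (p - v s y) - Q / 2 * s"])
    show "a \<le> a + h" using assms by simp
    fix s assume s: "a \<le> s" "s \<le> a + h"
    then have s0: "s \<ge> 0" using assms by simp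
    define w where "w = \<Delta> (U s) y + \<Gamma> (U s) (U s) y + n / (2 * (s + t0))"
    have pos: "p - v s y > 0" using below[OF s] by simp
    have "((\<lambda>s. 1 / (p - v s y) - Q / 2 * s) has_real_derivative w / (p - v s y)\<^sup>2 - Q / 2) (at s)"
      using v_deriv[OF s0, of y] pos unfolding w_def
      by (auto intro!: derivative_eq_intros simp: power2_eq_square)
    moreover have "Q / 2 * (p - v s y)\<^sup>2 \<le> w"
    proof -
      \<comment> \<open>\<open>v\<close> at \<open>z\<close> has not decreased since time
        \<open>a\<close>, and the logarithms at \<open>z\<close> and \<open>y\<close> cancel at
        equal times.\<close>
      have "p - v s y \<le> U s z - U s y"
        using v_mono[of a s z] s assms by (simp add: p_def v_def)
      then have "(p - v s y)\<^sup>2 \<le> (U s z - U s y)\<^sup>2" using pos by (intro power_mono) auto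
      then have "Q / 2 * (p - v s y)\<^sup>2 \<le> Q / 2 * (U s z - U s y)\<^sup>2" using Q_pos by (intro mult_left_mono) auto
      also have "\<dots> \<le> \<Gamma> (U s) (U s) y" by (rule Gamma_edge_bound[OF qyz])
      also have "\<dots> \<le> w" unfolding w_def by (rule v_deriv_ge[OF s0])
      finally show ?thesis .
    qed
    then have "0 \<le> w / (p - v s y)\<^sup>2 - Q / 2" using pos by (simp add: pos_le_divide_eq)
    ultimately show "\<exists>d. ((\<lambda>s. 1 / (p - v s y) - Q / 2 * s) has_real_derivative d) (at s) \<and> 0 \<le> d" by blast
  qed
  moreover have "1 / (p - v a y) > 0" using below[of a] assms by simp
  moreover have "Q * h / 2 = Q / 2 * (a + h) - Q / 2 * a" by (simp add: algebra_simps add_divide_distrib)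
  ultimately have "Q * h / 2 \<le> 1 / (p - v (a + h) y)" by linarith
  moreover have "p - v (a + h) y > 0" using below[of "a + h"] assms by simp
  ultimately have "Q * h / 2 * (p - v (a + h) y) \<le> 1" by (simp only: pos_le_divide_eq)
  then have "p - v (a + h) y \<le> 2 / (Q * h)" using Qh by (simp add: pos_le_divide_eq mult_ac)
  then show False using neg by (simp add: p_def)
qed

lemma Harnack_path:
  assumes "(adj q ^^ k) z y" "0 \<le> a" "h > 0"
  shows "v a z - k * (2 / (Q * h)) \<le> v (a + k * h) y"
  using assms(1)
proof (induction k arbitrary: y)
  case 0
  then show ?case by simp
next
  case (Suc k)
  from Suc.prems obtain w where w: "(adj q ^^ k) z w" "adj q w y" by auto
  have "0 \<le> a + k * h" using assms by simp
  from Harnack_edge[OF w(2) this assms(3)] Suc.IH[OF w(1)]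
  show ?case by (simp add: algebra_simps add_divide_distrib)
qed

text \<open>The time \<open>b - a\<close> is divided evenly among the \<open>k\<close> edges, each
  of which costs \<open>2 * k / (Q * (b - a))\<close>.\<close>

lemma Harnack:
  assumes path: "(adj q ^^ k) z y" and k: "real k \<le> \<kappa>" and ab: "0 \<le> a" "a < b"
  shows "U a z - n / 2 * ln ((b + t0) / (a + t0)) - 2 * \<kappa>\<^sup>2 / (Q * (b - a)) \<le> U b y"
proof -
  have "v a z - 2 * (real k)\<^sup>2 / (Q * (b - a)) \<le> v b y"
  proof (cases "k = 0")
    case True
    then show ?thesis using v_mono[of a b y] path ab by simp
  next
    case False
    have "v a z - k * (2 / (Q * ((b - a) / k))) \<le> v (a + k * ((b - a) / k)) y"
      by (rule Harnack_path) (use path ab False in auto)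
    then show ?thesis using False by (simp add: power2_eq_square field_simps)
  qed
  moreover have "2 * (real k)\<^sup>2 / (Q * (b - a)) \<le> 2 * \<kappa>\<^sup>2 / (Q * (b - a))"
    using k ab Q_pos by (intro divide_right_mono mult_left_mono power_mono) auto
  moreover have "n / 2 * ln ((b + t0) / (a + t0)) = n / 2 * ln (b + t0) - n / 2 * ln (a + t0)"
    using ab t0_pos by (simp add: ln_div right_diff_distrib)
  ultimately show ?thesis unfolding v_def by linarith
qed

section \<open>Decay and transport of the exponential mass\<close>

definition "\<alpha> = 1 + 1 / (8 * n)"

definition "mass \<psi> t = (\<Sum>x\<in>UNIV. \<mu> x * (\<psi> x * exp (\<alpha> * U t x)))"

abbreviation "A \<equiv> mass (\<lambda>_. 1)"

definition "mass' \<psi> t = \<alpha> * (\<Sum>x\<in>UNIV. \<mu> x * (\<psi> x * exp (\<alpha> * U t x) * (\<Delta> (U t) x + \<Gamma> (U t) (U t) x)))"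

lemma alpha_bounds: "\<alpha> > 1" "\<alpha> \<le> 9 / 8"
  using n_pos dimension_ge_1 by (simp_all add: \<alpha>_def field_simps)

lemma mass_deriv: "t \<ge> 0 \<Longrightarrow> (mass \<psi> has_real_derivative mass' \<psi> t) (at t)"
  unfolding mass_def[abs_def] mass'_def
  by (rule derivative_eq_intros flow refl | assumption)+ (simp add: sum_distrib_left mult_ac)

lemma A_pos: "A t > 0"
proof -
  obtain x where "\<mu> x > 0" using weight_nontrivial by blast
  then show ?thesis unfolding mass_def using weight_nonneg
    by (intro sum_pos2[of UNIV x]) auto
qed

text \<open>The second bound dictates the value of \<alpha>: \<open>edge_supersolution\<close> needs
  \<open>1 + s^2/8\<close>, and the flow has \<open>s^2 \<le> 1/n\<close> on every edge.\<close>

lemma edge_gradient_le_1: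
  assumes "t \<ge> 0" "q x y > 0"
  shows "\<bar>U t y - U t x\<bar> \<le> 1" "\<alpha> \<ge> 1 + (U t y - U t x)\<^sup>2 / 8"
proof -
  have "(U t y - U t x)\<^sup>2 \<le> 1 / n" by (rule edge_gradient[OF assms])
  then show "\<alpha> \<ge> 1 + (U t y - U t x)\<^sup>2 / 8" by (simp add: \<alpha>_def)
  have "1 / n \<le> 1" using dimension_ge_1 by simp
  then have "(U t y - U t x)\<^sup>2 \<le> 1" using edge_gradient[OF assms] by simp
  then show "\<bar>U t y - U t x\<bar> \<le> 1" by (simp add: abs_square_le_1)
qed

lemma exp_edge: "exp (\<alpha> * U t y) = exp (\<alpha> * U t x) * exp (\<alpha> * (U t y - U t x))"
  by (simp add: exp_add[symmetric] algebra_simps)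

lemma energy_sum: "(\<Sum>x\<in>UNIV. \<mu> x * (h x * (\<Delta> f x + c * \<Gamma> f f x)))
   = (\<Sum>x\<in>UNIV. \<mu> x * (\<Sum>y\<in>UNIV. q x y * (h x * ((f y - f x) + c * (f y - f x)\<^sup>2 / 2))))"
proof (intro sum.cong refl)
  fix x
  have "\<Delta> f x + c * \<Gamma> f f x = (\<Sum>y\<in>UNIV. q x y * ((f y - f x) + c * (f y - f x)\<^sup>2 / 2))"
    unfolding Gamma_one_eq laplacian_def sum_divide_distrib sum_distrib_left
    by (simp add: distrib_left sum.distrib power2_eq_square mult_ac)
  then show "\<mu> x * (h x * (\<Delta> f x + c * \<Gamma> f f x)) = \<mu> x * (\<Sum>y\<in>UNIV. q x y * (h x * ((f y - f x) + c * (f y - f x)\<^sup>2 / 2)))"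
    by (simp add: sum_distrib_left mult_ac)
qed

lemma mass_decay_sum:
  assumes t: "t \<ge> 0"
  shows "(\<Sum>x\<in>UNIV. \<mu> x * (exp (\<alpha> * U t x) * (\<Delta> (U t) x + \<Gamma> (U t) (U t) x))) \<le> 0"
proof -
  have "(\<Sum>x\<in>UNIV. \<mu> x * (\<Sum>y\<in>UNIV. q x y * (exp (\<alpha> * U t x) * ((U t y - U t x) + 1 * (U t y - U t x)\<^sup>2 / 2))))
    \<le> (\<Sum>x\<in>UNIV. \<mu> x * (\<Sum>y\<in>UNIV. q x y * 0))"
  proof (rule W.edge_sum_mono)
    fix x y assume q: "q x y > 0"
    define s where "s = U t y - U t x"
    have "exp (\<alpha> * U t x) * ((s + s\<^sup>2 / 2) + exp (\<alpha> * s) * (- s + s\<^sup>2 / 2)) \<le> 0"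
      using edge_supersolution[of s \<alpha>] edge_gradient_le_1[OF t q]
      by (intro mult_nonneg_nonpos) (auto simp: s_def)
    moreover have neg: "U t x - U t y = - s" by (simp add: s_def)
    ultimately show "exp (\<alpha> * U t x) * ((U t y - U t x) + 1 * (U t y - U t x)\<^sup>2 / 2) +
       exp (\<alpha> * U t y) * ((U t x - U t y) + 1 * (U t x - U t y)\<^sup>2 / 2) \<le> 0 + 0"
      unfolding exp_edge[of t y x] neg s_def[symmetric] by (simp add: algebra_simps)
  qed
  then show ?thesis using energy_sum[of "\<lambda>x. exp (\<alpha> * U t x)" "U t" 1] by simp
qed

lemma weighted_laplacian_ge:
  assumes t: "t \<ge> 0"
  shows "(\<Sum>x\<in>UNIV. \<mu> x * (exp (\<alpha> * U t x) * \<Delta> (U t) x)) \<ge> - n / (2 * (t + t0)) * A t"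
proof -
  have "- n / (2 * (t + t0)) * A t = (\<Sum>x\<in>UNIV. \<mu> x * (exp (\<alpha> * U t x) * (- n / (2 * (t + t0)))))"
    unfolding mass_def sum_distrib_left by (simp add: mult_ac)
  also have "\<dots> \<le> (\<Sum>x\<in>UNIV. \<mu> x * (exp (\<alpha> * U t x) * \<Delta> (U t) x))"
    by (intro sum_mono mult_left_mono Li_Yau t weight_nonneg) auto
  finally show ?thesis .
qed

text \<open>Decay of the mass bounds the weighted sum of \<open>\<Gamma> u u\<close> by that of
  \<open>- \<Delta> u\<close>, which Li--Yau bounds pointwise.\<close>

lemma weighted_Gamma_le:
  assumes t: "t \<ge> 0"
  shows "(\<Sum>x\<in>UNIV. \<mu> x * (exp (\<alpha> * U t x) * \<Gamma> (U t) (U t) x)) \<le> n / (2 * (t + t0)) * A t"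
  using mass_decay_sum[OF t] weighted_laplacian_ge[OF t]
  by (simp add: distrib_left sum.distrib)

lemma A_deriv_le: "t \<ge> 0 \<Longrightarrow> mass' (\<lambda>_. 1) t \<le> 0"
  unfolding mass'_def using mass_decay_sum[of t] alpha_bounds
  by (intro mult_nonneg_nonpos) auto

lemma A_antimono:
  assumes "0 \<le> s" "s \<le> t"
  shows "A t \<le> A s"
proof (rule DERIV_nonpos_imp_nonincreasing[OF assms(2)])
  fix r assume "s \<le> r" "r \<le> t"
  then have "r \<ge> 0" using assms by simp
  then show "\<exists>y. (A has_real_derivative y) (at r) \<and> y \<le> 0"
    using mass_deriv A_deriv_le by blast
qed

text \<open>\<open>\<alpha> * (\<Delta> u + \<Gamma> u u)\<close> is
  \<open>(\<alpha> - 1) * \<Delta> u\<close> plus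
  \<open>\<Delta> u + \<alpha> * \<Gamma> u u\<close>. The second part has nonnegative weighted sum
  by \<open>edge_subsolution\<close>, the first is controlled by Li--Yau, and
  \<open>(\<alpha> - 1) * n / 2 = 1 / 16\<close>.\<close>

lemma A_deriv_ge:
  assumes t: "t \<ge> 0"
  shows "- (1 / 16) / (t + t0) * A t \<le> mass' (\<lambda>_. 1) t"
proof -
  let ?e = "\<lambda>x. exp (\<alpha> * U t x)"
  have "(\<Sum>x\<in>UNIV. \<mu> x * (\<Sum>y\<in>UNIV. q x y * 0)) \<le>
     (\<Sum>x\<in>UNIV. \<mu> x * (\<Sum>y\<in>UNIV. q x y * (?e x * ((U t y - U t x) + \<alpha> * (U t y - U t x)\<^sup>2 / 2))))"
  proof (rule W.edge_sum_mono)
    fix x y assume q: "q x y > 0"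
    define s where "s = U t y - U t x"
    have "0 \<le> ?e x * ((s + \<alpha> * s\<^sup>2 / 2) + exp (\<alpha> * s) * (- s + \<alpha> * s\<^sup>2 / 2))"
      using edge_subsolution[of \<alpha> s] alpha_bounds by (intro mult_nonneg_nonneg) auto
    moreover have neg: "U t x - U t y = - s" by (simp add: s_def)
    ultimately show "0 + 0 \<le> ?e x * ((U t y - U t x) + \<alpha> * (U t y - U t x)\<^sup>2 / 2) +
       ?e y * ((U t x - U t y) + \<alpha> * (U t x - U t y)\<^sup>2 / 2)"
      unfolding exp_edge[of t y x] neg s_def[symmetric] by (simp add: algebra_simps)
  qed
  then have nn: "0 \<le> (\<Sum>x\<in>UNIV. \<mu> x * (?e x * (\<Delta> (U t) x + \<alpha> * \<Gamma> (U t) (U t) x)))"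
    using energy_sum[of ?e "U t" \<alpha>] by simp
  have "- (1 / 16) / (t + t0) * A t = (\<alpha> - 1) * (- n / (2 * (t + t0)) * A t)"
    using n_pos t t0_pos by (simp add: \<alpha>_def field_simps)
  also have "\<dots> \<le> (\<alpha> - 1) * (\<Sum>x\<in>UNIV. \<mu> x * (?e x * \<Delta> (U t) x))"
    using weighted_laplacian_ge[OF t] alpha_bounds by (intro mult_left_mono) auto
  also have "\<dots> \<le> (\<alpha> - 1) * (\<Sum>x\<in>UNIV. \<mu> x * (?e x * \<Delta> (U t) x)) + (\<Sum>x\<in>UNIV. \<mu> x * (?e x * (\<Delta> (U t) x + \<alpha> * \<Gamma> (U t) (U t) x)))"
    using nn by simp
  also have "\<dots> = mass' (\<lambda>_. 1) t"
    unfolding mass'_def sum_distrib_left sum.distrib[symmetric]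
    by (intro sum.cong refl) (simp add: algebra_simps)
  finally show ?thesis .
qed

text \<open>By Cauchy--Schwarz the drift is controlled by the weighted mean of \<open>\<Gamma> u\<close>, hence by \<open>n/(2\<tau>)\<close>: it is diffusive,
  not ballistic.\<close>
lemma mean_gradient_le:
  assumes t: "t \<ge> 0"
  shows "(\<Sum>x\<in>UNIV. \<mu> x * (exp (\<alpha> * U t x) * (\<Sum>y\<in>UNIV. q x y * \<bar>U t y - U t x\<bar>))) \<le> sqrt (D * n / (t + t0)) * A t"
proof -
  let ?e = "\<lambda>x. exp (\<alpha> * U t x)"
  define \<tau> where "\<tau> = t + t0"
  have \<tau>: "\<tau> > 0" using t t0_pos by (simp add: \<tau>_def)
  \<comment> \<open>This \<open>l\<close> balances the two final terms:
    \<open>l * n / (2 * \<tau>) = D / (2 * l)\<close>.\<close>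
  define l where "l = sqrt (D * \<tau> / n)"
  have l: "l > 0" using D_pos \<tau> n_pos by (simp add: l_def)
  have l2: "l\<^sup>2 = D * \<tau> / n" using D_pos \<tau> n_pos by (simp add: l_def)
  have Dl: "sqrt (D * n / \<tau>) = D / l"
  proof (rule real_sqrt_unique)
    show "(D / l)\<^sup>2 = D * n / \<tau>" using D_pos \<tau> n_pos by (simp add: power_divide l2) (simp add: power2_eq_square)
  qed (use l D_pos in simp)
  have row: "(\<Sum>y\<in>UNIV. q x y * \<bar>U t y - U t x\<bar>) \<le> l * \<Gamma> (U t) (U t) x + D / (2 * l)" for x
  proof -
    have "(\<Sum>y\<in>UNIV. q x y * \<bar>U t y - U t x\<bar>) \<le> (\<Sum>y\<in>UNIV. q x y * (l / 2 * (U t y - U t x)\<^sup>2 + 1 / (2 * l)))"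
    proof (intro sum_mono mult_left_mono q_ge_0)
      fix y
      define s where "s = \<bar>U t y - U t x\<bar>"
      have "0 \<le> (l * s - 1)\<^sup>2" by simp
      then have "2 * (l * s) \<le> l\<^sup>2 * s\<^sup>2 + 1" by (simp add: power2_eq_square algebra_simps)
      then have "s \<le> l / 2 * s\<^sup>2 + 1 / (2 * l)" using l by (simp add: field_simps power2_eq_square)
      then show "\<bar>U t y - U t x\<bar> \<le> l / 2 * (U t y - U t x)\<^sup>2 + 1 / (2 * l)" by (simp add: s_def)
    qed
    also have "\<dots> = l * \<Gamma> (U t) (U t) x + (\<Sum>y\<in>UNIV. q x y) * (1 / (2 * l))"
      unfolding Gamma_one_eq sum_distrib_left sum_distrib_right sum_divide_distrib sum.distrib[symmetric]
      using l by (intro sum.cong refl) (simp add: power2_eq_square field_simps)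
    also have "\<dots> \<le> l * \<Gamma> (U t) (U t) x + D * (1 / (2 * l))"
      using degree_le l by (intro add_left_mono mult_right_mono) auto
    finally show ?thesis by simp
  qed
  have "(\<Sum>x\<in>UNIV. \<mu> x * (?e x * (\<Sum>y\<in>UNIV. q x y * \<bar>U t y - U t x\<bar>)))
     \<le> (\<Sum>x\<in>UNIV. \<mu> x * (?e x * (l * \<Gamma> (U t) (U t) x + D / (2 * l))))"
    by (intro sum_mono mult_left_mono row weight_nonneg) auto
  also have "\<dots> = l * (\<Sum>x\<in>UNIV. \<mu> x * (?e x * \<Gamma> (U t) (U t) x)) + D / (2 * l) * A t"
    unfolding mass_def sum_distrib_left sum.distrib[symmetric]
    by (intro sum.cong refl) (simp add: algebra_simps)
  also have "\<dots> \<le> l * (n / (2 * \<tau>) * A t) + D / (2 * l) * A t"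
    using weighted_Gamma_le[OF t] l by (intro add_right_mono mult_left_mono) (auto simp: \<tau>_def)
  also have "l * (n / (2 * \<tau>) * A t) = D / (2 * l) * A t"
  proof -
    have "l * n * l = D * \<tau>" using l2 n_pos by (simp add: power2_eq_square field_simps)
    then have "l * (n / (2 * \<tau>)) = D / (2 * l)" using l \<tau> by (simp add: field_simps)
    then show ?thesis by (simp only: mult.assoc[symmetric])
  qed
  finally show ?thesis unfolding \<tau>_def[symmetric] Dl by simp
qed

text \<open>On each edge \<open>edge_drift\<close> leaves only the variation of
  \<open>\<psi>\<close>, multiplied by the absolute increment that \<open>mean_gradient_le\<close>
  controls.\<close>

lemma mass_deriv_le:
  assumes t: "t \<ge> 0" and \<psi>: "\<And>x. \<psi> x \<ge> 0" "\<And>x y. q x y > 0 \<Longrightarrow> \<bar>\<psi> x - \<psi> y\<bar> \<le> l" and l: "l \<ge> 0"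
  shows "mass' \<psi> t \<le> \<alpha> * l / 2 * sqrt (D * n / (t + t0)) * A t"
proof -
  let ?e = "\<lambda>x. exp (\<alpha> * U t x)"
  have "(\<Sum>x\<in>UNIV. \<mu> x * (\<Sum>y\<in>UNIV. q x y * (\<psi> x * ?e x * ((U t y - U t x) + 1 * (U t y - U t x)\<^sup>2 / 2))))
    \<le> (\<Sum>x\<in>UNIV. \<mu> x * (\<Sum>y\<in>UNIV. q x y * (l / 2 * ?e x * \<bar>U t y - U t x\<bar>)))"
  proof (rule W.edge_sum_mono)
    fix x y assume q: "q x y > 0"
    define s where "s = U t y - U t x"
    have "?e x * (\<psi> x * (s + s\<^sup>2 / 2) + \<psi> y * exp (\<alpha> * s) * (- s + s\<^sup>2 / 2)) \<le> ?e x * (l / 2 * \<bar>s\<bar> * (1 + exp (\<alpha> * s)))"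
      using edge_drift[of s \<alpha> "\<psi> x" "\<psi> y" l] edge_gradient_le_1[OF t q] \<psi>(1) \<psi>(2)[OF q]
      by (intro mult_left_mono) (auto simp: s_def)
    moreover have neg: "U t x - U t y = - s" by (simp add: s_def)
    ultimately show "\<psi> x * ?e x * ((U t y - U t x) + 1 * (U t y - U t x)\<^sup>2 / 2) +
       \<psi> y * ?e y * ((U t x - U t y) + 1 * (U t x - U t y)\<^sup>2 / 2) \<le> l / 2 * ?e x * \<bar>U t y - U t x\<bar> + l / 2 * ?e y * \<bar>U t x - U t y\<bar>"
      unfolding exp_edge[of t y x] neg s_def[symmetric] by (simp add: algebra_simps)
  qed
  also have "\<dots> = l / 2 * (\<Sum>x\<in>UNIV. \<mu> x * (?e x * (\<Sum>y\<in>UNIV. q x y * \<bar>U t y - U t x\<bar>)))"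
    by (simp add: sum_distrib_left mult_ac)
  also have "\<dots> \<le> l / 2 * (sqrt (D * n / (t + t0)) * A t)"
    using mean_gradient_le[OF t] l by (intro mult_left_mono) auto
  finally have "\<alpha> * (\<Sum>x\<in>UNIV. \<mu> x * (\<psi> x * ?e x * (\<Delta> (U t) x + 1 * \<Gamma> (U t) (U t) x))) \<le> \<alpha> * (l / 2 * (sqrt (D * n / (t + t0)) * A t))"
    unfolding energy_sum using alpha_bounds by (intro mult_left_mono) auto
  then show ?thesis by (simp add: mass'_def mult_ac)
qed

text \<open>The quotient \<open>b = mass \<psi> / A\<close> satisfies
  \<open>b' \<le> c / sqrt \<tau> + b / (16 * \<tau>)\<close>, the last term because
  \<open>A\<close> may shrink. Gronwall's argument uses the integrating factor
  \<open>\<tau> powr (- 1 / 16)\<close>.\<close>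

lemma mean_drift:
  assumes t: "t \<ge> 0" and \<psi>: "\<And>x. \<psi> x \<ge> 0" "\<And>x y. q x y > 0 \<Longrightarrow> \<bar>\<psi> x - \<psi> y\<bar> \<le> l" and l: "l \<ge> 0"
  shows "mass \<psi> t / A t \<le> mass \<psi> 0 / A 0 * ((t + t0) / t0) powr (1 / 16) + 9 / 7 * l * sqrt (D * n * (t + t0))"
proof -
  define c where "c = \<alpha> * l / 2 * sqrt (D * n)"
  \<comment> \<open>The subtracted term is an antiderivative of
    \<open>c * \<tau> powr (- 9 / 16)\<close>, the drift times the integrating factor.\<close>
  define f where "f s = mass \<psi> s / A s * (s + t0) powr (- 1 / 16) - 16 / 7 * c * (s + t0) powr (7 / 16)" for s
  have "f t \<le> f 0"
  proof (rule DERIV_nonpos_imp_nonincreasing[OF t])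
    fix s assume s: "0 \<le> s" "s \<le> t"
    define \<tau> where "\<tau> = s + t0"
    have \<tau>: "\<tau> > 0" using s t0_pos by (simp add: \<tau>_def)
    define b where "b = mass \<psi> s / A s"
    define b' where "b' = (mass' \<psi> s * A s - mass \<psi> s * mass' (\<lambda>_. 1) s) / (A s * A s)"
    have b0: "mass \<psi> s \<ge> 0" unfolding mass_def using weight_nonneg \<psi>(1) by (intro sum_nonneg) simp
    have 1: "((\<lambda>s. mass \<psi> s / A s) has_real_derivative b') (at s)"
      unfolding b'_def using DERIV_divide[OF mass_deriv[OF s(1)] mass_deriv[OF s(1)], of "\<lambda>_. 1" \<psi>] A_pos[of s] by simp
    have 2: "((\<lambda>s. (s + t0) powr p) has_real_derivative p * \<tau> powr (p - 1)) (at s)" for p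
      unfolding \<tau>_def using \<tau> \<tau>_def by (auto intro!: derivative_eq_intros)
    have "(f has_real_derivative b' * \<tau> powr (- 1 / 16) + (- 1 / 16) * \<tau> powr (- 1 / 16 - 1) * b
        - 16 / 7 * c * (7 / 16 * \<tau> powr (7 / 16 - 1))) (at s)"
      unfolding f_def[abs_def] b_def
      by (rule derivative_eq_intros 1 2 refl)+ (simp add: \<tau>_def)
    moreover have "b' * \<tau> powr (- 1 / 16) + (- 1 / 16) * \<tau> powr (- 1 / 16 - 1) * b
        - 16 / 7 * c * (7 / 16 * \<tau> powr (7 / 16 - 1)) \<le> 0"
    proof -
      have "b' = mass' \<psi> s / A s + b * (- mass' (\<lambda>_. 1) s / A s)"
        using A_pos[of s] by (simp add: b'_def b_def field_simps)
      also have "mass' \<psi> s / A s \<le> c / sqrt \<tau>"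
      proof -
        have "mass' \<psi> s \<le> c / sqrt \<tau> * A s"
          using mass_deriv_le[OF s(1) \<psi> l] by (simp add: c_def \<tau>_def real_sqrt_divide)
        then show ?thesis using A_pos[of s] by (simp add: pos_divide_le_eq)
      qed
      also have "b * (- mass' (\<lambda>_. 1) s / A s) \<le> b * (1 / 16 / \<tau>)"
      proof (rule mult_left_mono)
        have "- mass' (\<lambda>_. 1) s \<le> 1 / 16 / \<tau> * A s" using A_deriv_ge[OF s(1)] by (simp add: \<tau>_def)
        then show "- mass' (\<lambda>_. 1) s / A s \<le> 1 / 16 / \<tau>" using A_pos[of s] by (simp only: pos_divide_le_eq)
      qed (use b0 A_pos[of s] in \<open>simp add: b_def\<close>)
      finally have "b' * \<tau> powr (- 1 / 16) \<le> (c / sqrt \<tau> + b * (1 / 16 / \<tau>)) * \<tau> powr (- 1 / 16)"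
        by (intro mult_right_mono) auto
      moreover have "\<tau> powr (- 1 / 16) / sqrt \<tau> = \<tau> powr (7 / 16 - 1)"
        using \<tau> by (simp add: powr_half_sqrt[symmetric] powr_diff[symmetric])
      moreover have "\<tau> powr (- 1 / 16) / \<tau> = \<tau> powr (- 1 / 16 - 1)"
        using powr_diff[of \<tau> "- 1 / 16" 1] \<tau> by simp
      moreover have "(c / sqrt \<tau> + b * (1 / 16 / \<tau>)) * \<tau> powr (- 1 / 16)
          = c * (\<tau> powr (- 1 / 16) / sqrt \<tau>) + b * (\<tau> powr (- 1 / 16) / \<tau>) / 16"
        by (simp add: distrib_right)
      ultimately show ?thesis by (simp add: algebra_simps)
    qed
    ultimately show "\<exists>y. (f has_real_derivative y) (at s) \<and> y \<le> 0" by blast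
  qed
  define \<tau> where "\<tau> = t + t0"
  have \<tau>: "\<tau> > 0" using t t0_pos by (simp add: \<tau>_def)
  have c0: "c \<ge> 0" using alpha_bounds l by (simp add: c_def D_pos less_imp_le n_pos)
  have "mass \<psi> t / A t * \<tau> powr (- 1 / 16) \<le> mass \<psi> 0 / A 0 * t0 powr (- 1 / 16) + 16 / 7 * c * \<tau> powr (7 / 16)"
    using \<open>f t \<le> f 0\<close> mult_nonneg_nonneg[OF c0 powr_ge_zero[of t0 "7/16"]] by (simp add: f_def \<tau>_def)
  then have "(mass \<psi> t / A t * \<tau> powr (- 1 / 16)) * \<tau> powr (1 / 16)
      \<le> (mass \<psi> 0 / A 0 * t0 powr (- 1 / 16) + 16 / 7 * c * \<tau> powr (7 / 16)) * \<tau> powr (1 / 16)"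
    by (intro mult_right_mono) auto
  moreover have "\<tau> powr (- 1 / 16) * \<tau> powr (1 / 16) = 1"
    using \<tau> by (simp add: powr_add[symmetric])
  moreover have "t0 powr (- 1 / 16) * \<tau> powr (1 / 16) = (\<tau> / t0) powr (1 / 16)"
    using \<tau> t0_pos by (simp add: powr_divide powr_minus field_simps)
  moreover have "\<tau> powr (7 / 16) * \<tau> powr (1 / 16) = sqrt \<tau>"
    using \<tau> by (simp add: powr_add[symmetric] powr_half_sqrt)
  ultimately have "mass \<psi> t / A t \<le> mass \<psi> 0 / A 0 * (\<tau> / t0) powr (1 / 16) + 16 / 7 * c * sqrt \<tau>"
    by (simp add: distrib_right mult.assoc)
  also have "16 / 7 * c * sqrt \<tau> \<le> 9 / 7 * l * sqrt (D * n * \<tau>)"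
  proof -
    have "16 / 7 * c * sqrt \<tau> = \<alpha> * (8 / 7 * (l * sqrt (D * n * \<tau>)))" by (simp add: c_def real_sqrt_mult)
    also have "\<dots> \<le> 9 / 8 * (8 / 7 * (l * sqrt (D * n * \<tau>)))"
      using alpha_bounds l D_pos n_pos \<tau> by (intro mult_right_mono) auto
    finally show ?thesis by simp
  qed
  finally show ?thesis by (simp add: \<tau>_def)
qed

end

section \<open>Volume doubling\<close>

locale pointed_cd_graph = cd_graph q m n
  for q :: "'v::finite \<Rightarrow> 'v \<Rightarrow> real" and m :: "'v \<Rightarrow> real" and n :: real +
  fixes x0 :: 'v
begin

section \<open>Distance and weight on the component of the base point\<close>

definition "reachable y \<longleftrightarrow> (\<exists>k. (adj q ^^ k) x0 y)"

text \<open>Vertices outside the component of \<open>x0\<close> get distance 0 and weight 0.\<close>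
definition "dn y = (if reachable y then LEAST k. (adj q ^^ k) x0 y else 0)"

definition "\<mu> y = (if reachable y then m y else 0)"

text \<open>Unreachable vertices may belong to the index set but have weight 0, so this is the
  volume of the ball.\<close>

definition "V \<rho> = (\<Sum>y | real (dn y) \<le> \<rho>. \<mu> y)"

text \<open>The width for which a function with edge increments at most \<open>1 / w\<close>
  satisfies the initial gradient bound, because \<open>D / w^2 = Q / n\<close>.\<close>

definition "w = sqrt (n * D / Q)"

lemma w_sq: "w\<^sup>2 = n * D / Q"
  unfolding w_def using n_pos D_pos Q_pos by simp

lemma w_ge_1: "w \<ge> 1"
proof -
  have "1 * Q \<le> n * D" using dimension_ge_1 Q_le_D Q_pos D_pos by (intro mult_mono) auto
  then show ?thesis unfolding w_def using Q_pos by simp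
qed

lemma Q_eq: "Q = n * D / w\<^sup>2"
  unfolding w_sq using n_pos D_pos Q_pos by simp

lemma dn_path: "reachable y \<Longrightarrow> (adj q ^^ dn y) x0 y"
  unfolding reachable_def dn_def by (auto intro: LeastI)

lemma dn_le: "(adj q ^^ k) x0 y \<Longrightarrow> dn y \<le> k"
  unfolding dn_def by (simp add: Least_le)

lemma reachable_x0: "reachable x0" unfolding reachable_def by (rule exI[of _ 0]) simp

lemma dn_x0: "dn x0 = 0" using dn_le[of 0 x0] by simp

lemma adj_step:
  assumes "adj q y z" "reachable y"
  shows "reachable z" "dn z \<le> Suc (dn y)"
proof -
  have "(adj q ^^ Suc (dn y)) x0 z" using dn_path[OF assms(2)] assms(1) by auto
  then show "reachable z" "dn z \<le> Suc (dn y)" using dn_le unfolding reachable_def by blast+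
qed

lemma reachable_adj: "adj q y z \<Longrightarrow> reachable y \<longleftrightarrow> reachable z"
  using adj_step adj_sym by metis

lemma dn_lipschitz:
  assumes "adj q y z"
  shows "\<bar>real (dn y) - real (dn z)\<bar> \<le> 1"
proof (cases "reachable y")
  case True
  then have "dn z \<le> Suc (dn y)" "dn y \<le> Suc (dn z)"
    using adj_step reachable_adj adj_sym assms by metis+
  then show ?thesis by linarith
next
  case False
  then show ?thesis using reachable_adj[OF assms] by (simp add: dn_def)
qed

lemma relpowp_adj_sym: "(adj q ^^ k) y z \<Longrightarrow> (adj q ^^ k) z y"
proof (induction k arbitrary: z)
  case (Suc k)
  then obtain u where "(adj q ^^ k) y u" "adj q u z" by auto
  then have "adj q z u" "(adj q ^^ k) u y" using Suc.IH adj_sym by auto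
  then show ?case by (rule relpowp_Suc_I2)
qed simp

lemma path_between:
  assumes "reachable y" "reachable z"
  shows "(adj q ^^ (dn y + dn z)) y z"
  using relpowp_adj_sym[OF dn_path[OF assms(1)]] dn_path[OF assms(2)]
  unfolding relpowp_add by blast

lemma mu_balance: "\<mu> y * q y z = \<mu> z * q z y"
proof (cases "q y z > 0")
  case True
  then show ?thesis using reachable_adj[of y z] adj_iff detailed_balance by (simp add: \<mu>_def)
next
  case False
  then have "q y z = 0" "q z y = 0"
    using q_pos_sym[of z y] q_ge_0[of y z] q_ge_0[of z y] by (force, force)
  then show ?thesis by simp
qed

lemma mu_nonneg: "\<mu> y \<ge> 0" using m_nonneg by (simp add: \<mu>_def)

lemma gball_eq: "gball q \<rho> x0 = {y. reachable y \<and> real (dn y) \<le> \<rho>}"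
proof (rule set_eqI)
  fix y
  have "gdist q x0 y = (if reachable y then enat (dn y) else \<infinity>)"
  proof (cases "reachable y")
    case True
    have "Inf {enat k |k. (adj q ^^ k) x0 y} = enat (dn y)"
    proof (rule antisym)
      show "Inf {enat k |k. (adj q ^^ k) x0 y} \<le> enat (dn y)"
        using dn_path[OF True] by (intro Inf_lower) auto
      show "enat (dn y) \<le> Inf {enat k |k. (adj q ^^ k) x0 y}"
        using dn_le by (intro Inf_greatest) auto
    qed
    then show ?thesis using True by (simp add: gdist_def)
  next
    case False
    then have "{enat k |k. (adj q ^^ k) x0 y} = {}" by (auto simp: reachable_def)
    then show ?thesis using False unfolding gdist_def by (simp add: top_enat_def)
  qed
  then show "y \<in> gball q \<rho> x0 \<longleftrightarrow> y \<in> {y. reachable y \<and> real (dn y) \<le> \<rho>}"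
    by (simp add: gball_def)
qed

lemma vol_gball: "vol m (gball q \<rho> x0) = V \<rho>"
proof -
  have "V \<rho> = (\<Sum>y\<in>gball q \<rho> x0. \<mu> y)"
    unfolding V_def gball_eq by (rule sum.mono_neutral_right) (auto simp: \<mu>_def)
  also have "\<dots> = vol m (gball q \<rho> x0)"
    unfolding vol_def gball_eq by (rule sum.cong) (auto simp: \<mu>_def)
  finally show ?thesis by simp
qed

section \<open>The tent function as initial datum\<close>

definition "tent y = - real (dn y) / w"

text \<open>Chosen so that the Li--Yau bound at time 0 is \<open>- D / w\<close>, the least
  Laplacian possible with edge increments at most \<open>1 / w\<close>.\<close>

definition "t0 = n * w / (2 * D)"

lemma t0_pos: "t0 > 0" unfolding t0_def using n_pos w_ge_1 D_pos by simp

lemma tent_lipschitz: "q y z > 0 \<Longrightarrow> \<bar>tent z - tent y\<bar> \<le> 1 / w"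
  using dn_lipschitz[of y z] adj_iff[of y z] w_ge_1
  by (simp add: tent_def abs_minus_commute divide_right_mono diff_divide_distrib[symmetric] flip: abs_div_pos)

lemma cone_flow_exists: "\<exists>U. U 0 = tent \<and> li_yau_flow q m n U t0 \<mu>"
proof -
  have 1: "\<Gamma> tent tent y \<le> Q / (2 * n)" for y
  proof -
    have "(\<Sum>z\<in>UNIV. q y z * (tent z - tent y) * (tent z - tent y)) \<le> (\<Sum>z\<in>UNIV. q y z * (1 / w)\<^sup>2)"
    proof (rule sum_mono)
      fix z
      show "q y z * (tent z - tent y) * (tent z - tent y) \<le> q y z * (1 / w)\<^sup>2"
      proof (cases "q y z > 0")
        case True
        then have "\<bar>tent z - tent y\<bar>\<^sup>2 \<le> (1 / w)\<^sup>2" by (intro power_mono tent_lipschitz) auto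
        then show ?thesis using True by (simp add: mult.assoc power2_eq_square[symmetric])
      qed (use q_ge_0[of y z] in simp)
    qed
    also have "\<dots> \<le> D * (1 / w)\<^sup>2"
      unfolding sum_distrib_right[symmetric] by (intro mult_right_mono degree_le) auto
    also have "\<dots> = Q / n" using n_pos D_pos Q_pos by (simp add: power_divide w_sq)
    finally show ?thesis unfolding Gamma_one_eq by simp
  qed
  have 2: "\<Delta> tent y \<ge> - n / (2 * t0)" for y
  proof -
    have "(\<Sum>z\<in>UNIV. q y z * - (1 / w)) \<le> \<Delta> tent y"
      unfolding laplacian_def
    proof (rule sum_mono)
      fix z
      show "q y z * - (1 / w) \<le> q y z * (tent z - tent y)"
      proof (cases "q y z > 0")
        case True
        then have "- (1 / w) \<le> tent z - tent y" using tent_lipschitz[of y z] by linarith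
        then show ?thesis using q_ge_0 by (rule mult_left_mono)
      qed (use q_ge_0[of y z] in simp)
    qed
    moreover have "D * - (1 / w) \<le> (\<Sum>z\<in>UNIV. q y z) * - (1 / w)"
      using degree_le[of y] w_ge_1 by (intro mult_right_mono_neg) auto
    moreover have "- n / (2 * t0) = D * - (1 / w)" using n_pos D_pos w_ge_1 by (simp add: t0_def)
    ultimately show ?thesis by (simp only: sum_distrib_right[symmetric])
  qed
  obtain U where U: "U 0 = tent"
    "\<forall>t\<ge>0. \<forall>x. ((\<lambda>s. U s x) has_real_derivative \<Delta> (U t) x + \<Gamma> (U t) (U t) x) (at t)"
    "\<forall>t\<ge>0. \<forall>x y. q x y > 0 \<longrightarrow> (U t y - U t x)\<^sup>2 \<le> 1 / n"
    "\<forall>t\<ge>0. \<forall>x. \<Delta> (U t) x \<ge> - n / (2 * (t + t0))"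
    using Li_Yau_flow_exists[OF 1 2 t0_pos] by blast
  have "li_yau_flow q m n U t0 \<mu>"
  proof unfold_locales
    show "\<exists>x. \<mu> x > 0" using reachable_x0 m_pos by (auto simp: \<mu>_def)
  qed (use U t0_pos mu_nonneg mu_balance in auto)
  then show ?thesis using U(1) by blast
qed

end

section \<open>Volume growth and tail of the initial mass\<close>

locale cone_flow = pointed_cd_graph q m n x0
  for q :: "'v::finite \<Rightarrow> 'v \<Rightarrow> real" and m :: "'v \<Rightarrow> real" and n :: real and x0 :: 'v +
  fixes U :: "real \<Rightarrow> 'v \<Rightarrow> real"
  assumes U0: "U 0 = tent"
    and li_yau: "li_yau_flow q m n U t0 \<mu>"
begin

sublocale F: li_yau_flow q m n U t0 \<mu> by (rule li_yau)

abbreviation "\<alpha> \<equiv> F.\<alpha>"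
abbreviation "A \<equiv> F.A"

text \<open>The Harnack factor for \<open>exp (\<alpha> * u)\<close> when \<open>p\<close> is the
  ratio of shifted times and the path term equals \<open>n / 2\<close>.\<close>

definition "P p = (exp 1 * p) powr (\<alpha> * n / 2)"

lemma P_pos: "p > 0 \<Longrightarrow> P p > 0" by (simp add: P_def)

lemma P_eq: "p > 0 \<Longrightarrow> P p = exp (\<alpha> * (n / 2 * ln p + n / 2))"
  by (simp add: P_def powr_def ln_mult algebra_simps)

lemma alpha_n: "\<alpha> * n = n + 1 / 8" using n_pos by (simp add: F.\<alpha>_def distrib_right)

lemma A0_eq: "A 0 = (\<Sum>y\<in>UNIV. \<mu> y * exp (- \<alpha> * dn y / w))"
  unfolding F.mass_def U0 tent_def by simp

text \<open>Since \<open>u\<close> vanishes at \<open>x0\<close> initially, Harnack bounds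
  \<open>exp (\<alpha> * u)\<close> below on the whole ball at time \<open>T\<close>, while the
  total mass is then at most \<open>A 0\<close>.\<close>

lemma growth:
  assumes \<rho>: "\<rho> > 0"
  shows "V \<rho> \<le> A 0 * P (1 + 8 * \<rho>\<^sup>2 * w / n ^ 3)"
proof -
  \<comment> \<open>Minimizes \<open>n / 2 * ln T + 2 * \<rho>^2 / (Q * T)\<close>; the path term
    becomes \<open>n / 2\<close>.\<close>
  define T where "T = 4 * \<rho>\<^sup>2 * w\<^sup>2 / (n\<^sup>2 * D)"
  define p where "p = 1 + 8 * \<rho>\<^sup>2 * w / n ^ 3"
  have w0: "w > 0" using w_ge_1 by simp
  have T: "T > 0" using \<rho> w0 n_pos D_pos by (simp add: T_def)
  have p: "p > 0" unfolding p_def using n_pos w0 by (intro add_pos_nonneg) auto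
  have p_eq: "(T + t0) / (0 + t0) = p"
  proof -
    have "T / t0 = 8 * \<rho>\<^sup>2 * w / n ^ 3"
      using n_pos w0 D_pos by (simp add: T_def t0_def field_simps power2_eq_square power3_eq_cube)
    then show ?thesis using t0_pos by (simp add: p_def add_divide_distrib)
  qed
  have c: "2 * \<rho>\<^sup>2 / (Q * (T - 0)) = n / 2"
    using \<rho> n_pos w0 D_pos by (simp add: T_def Q_eq field_simps power2_eq_square)
  have ptw: "1 / P p \<le> exp (\<alpha> * U T y)" if y: "reachable y" "real (dn y) \<le> \<rho>" for y
  proof -
    have "U 0 x0 - n / 2 * ln ((T + t0) / (0 + t0)) - 2 * \<rho>\<^sup>2 / (Q * (T - 0)) \<le> U T y"
      by (rule F.Harnack[OF dn_path]) (use y T in auto)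
    then have "- (n / 2 * ln p + n / 2) \<le> U T y"
      unfolding p_eq c by (simp add: U0 tent_def dn_x0)
    then have "\<alpha> * - (n / 2 * ln p + n / 2) \<le> \<alpha> * U T y"
      using F.alpha_bounds by (intro mult_left_mono) auto
    then have "exp (- (\<alpha> * (n / 2 * ln p + n / 2))) \<le> exp (\<alpha> * U T y)"
      by (simp only: exp_le_cancel_iff mult_minus_right)
    then show ?thesis unfolding P_eq[OF p] by (simp add: exp_minus inverse_eq_divide)
  qed
  have "V \<rho> * (1 / P p) \<le> (\<Sum>y | real (dn y) \<le> \<rho>. \<mu> y * exp (\<alpha> * U T y))"
    unfolding V_def sum_distrib_right
  proof (rule sum_mono)
    fix y assume "y \<in> {y. real (dn y) \<le> \<rho>}"
    then show "\<mu> y * (1 / P p) \<le> \<mu> y * exp (\<alpha> * U T y)"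
      using mult_left_mono[OF ptw[of y] mu_nonneg[of y]] by (cases "reachable y") (simp_all add: \<mu>_def)
  qed
  also have "\<dots> \<le> A T"
    unfolding F.mass_def using mu_nonneg by (simp add: sum_mono2)
  also have "\<dots> \<le> A 0" using T by (intro F.A_antimono) auto
  finally show ?thesis using P_pos[OF p] by (simp add: p_def field_simps)
qed

text \<open>Tangent-line bounds for logarithms trade polynomial growth for the exponential rate
  \<open>\<alpha> / (4 * w)\<close>, a quarter of the decay rate of the initial density.\<close>

lemma growth_exp:
  assumes \<rho>: "\<rho> \<ge> 4 * n * w\<^sup>2"
  shows "V \<rho> \<le> A 0 * exp (\<alpha> * (\<rho> / (4 * w) + 3 / 2 * n * w + 11 / 25 * n))"
proof -
  have w0: "w > 0" using w_ge_1 by simp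
  define s where "s = \<rho> / (n * w\<^sup>2)"
  have s: "s \<ge> 4" using \<rho> n_pos w0 by (simp add: s_def pos_le_divide_eq mult.assoc)
  have \<rho>s: "\<rho> = s * n * w\<^sup>2" using n_pos w0 by (simp add: s_def)
  define p where "p = 1 + 8 * \<rho>\<^sup>2 * w / n ^ 3"
  have p0: "p \<ge> 1" unfolding p_def using n_pos w0 by simp
  \<comment> \<open>\<open>8 * s^2 * w^5\<close> is 128 times the bracket, and the bracket is at
    least 1.\<close>
  have "p \<le> 129 * ((s * w / 4)\<^sup>2 * w ^ 3)"
  proof -
    have "p = 1 + 8 * s\<^sup>2 * w ^ 5 / n"
      unfolding p_def \<rho>s using n_pos by (simp add: power2_eq_square power3_eq_cube eval_nat_numeral)
    moreover have "8 * s\<^sup>2 * w ^ 5 / n \<le> 8 * s\<^sup>2 * w ^ 5 / 1"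
      using dimension_ge_1 w0 by (intro divide_left_mono) auto
    moreover have "1 \<le> s\<^sup>2 / 16 * w ^ 5"
    proof -
      have "4\<^sup>2 \<le> s\<^sup>2" using s by (intro power_mono) auto
      moreover have "1 \<le> w ^ 5" using w_ge_1 by simp
      ultimately have "1 * 1 \<le> s\<^sup>2 / 16 * w ^ 5" by (intro mult_mono) auto
      then show ?thesis by simp
    qed
    ultimately have "p \<le> s\<^sup>2 / 16 * w ^ 5 + 8 * s\<^sup>2 * w ^ 5 / 1" by linarith
    also have "\<dots> = 129 * ((s * w / 4)\<^sup>2 * w ^ 3)" by (simp add: power2_eq_square eval_nat_numeral)
    finally show ?thesis .
  qed
  then have "ln p \<le> ln (129 * ((s * w / 4)\<^sup>2 * w ^ 3))" using p0 s w0 by simp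
  also have "\<dots> = ln 129 + (2 * ln (s * w / 4) + 3 * ln w)"
    using s w0 by (simp add: ln_mult ln_realpow)
  also have "ln (129 :: real) \<le> 488 / 100"
  proof -
    have "ln (128 :: real) = 7 * ln 2" using ln_realpow[of "2 :: real" 7] by simp
    then have "ln (129 :: real) = 7 * ln 2 + ln (1 + 1 / 128)"
      using ln_mult[of 128 "1 + 1 / 128 :: real"] by simp
    also have "\<dots> \<le> 7 * (25 / 36) + 1 / 128"
      using ln2_le_25_over_36 ln_add_one_self_le_self[of "1 / 128"] by (intro add_mono mult_left_mono) auto
    finally show ?thesis by simp
  qed
  also have "ln (s * w / 4) \<le> s * w / 4 - 1" using s w0 by (intro ln_le_minus_one) auto
  also have "ln w \<le> w - 1" using w0 by (intro ln_le_minus_one) auto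
  finally have lnp: "ln p \<le> 488 / 100 + (2 * (s * w / 4 - 1) + 3 * (w - 1))" by simp
  have "n / 2 * ln p + n / 2 \<le> n / 2 * (488 / 100 + (2 * (s * w / 4 - 1) + 3 * (w - 1))) + n / 2"
    using lnp n_pos by (intro add_right_mono mult_left_mono) auto
  \<comment> \<open>The last coefficient is
    \<open>(488/100 - 2 - 3 + 1) / 2 = 11/25\<close>.\<close>
  also have "\<dots> = \<rho> / (4 * w) + 3 / 2 * n * w + 11 / 25 * n"
    unfolding \<rho>s using w0 by (simp add: power2_eq_square field_simps)
  finally have "P p \<le> exp (\<alpha> * (\<rho> / (4 * w) + 3 / 2 * n * w + 11 / 25 * n))"
    using p0 F.alpha_bounds by (simp add: P_eq)
  moreover have "V \<rho> \<le> A 0 * P p"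
    unfolding p_def by (rule growth) (use s n_pos w0 in \<open>simp add: \<rho>s\<close>)
  ultimately show ?thesis
    using F.A_pos[of 0] by (meson mult_left_mono order_trans less_imp_le)
qed

text \<open>Summation over distance spheres: at distance \<open>k\<close>, growth at rate
  \<open>\<alpha> / (4 * w)\<close> against decay at rate \<open>\<alpha> / w\<close> leaves
  \<open>exp (- c * k)\<close>, and a geometric series remains.\<close>

lemma tail:
  assumes \<rho>: "\<rho> \<ge> 4 * n * w\<^sup>2"
  shows "(\<Sum>y | \<rho> < real (dn y). \<mu> y * exp (- \<alpha> * dn y / w))
    \<le> A 0 * ((1 + 4 / 3 * w) * exp (- (\<alpha> * n) * (3 / 4 * \<rho> / (n * w) - 3 / 2 * w - 11 / 25)))"
proof -
  have w0: "w > 0" using w_ge_1 by simp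
  have \<rho>0: "\<rho> \<ge> 0" using \<rho> n_pos by (smt (verit) mult_nonneg_nonneg zero_le_power2)
  define K where "K = Max (range dn)"
  \<comment> \<open>The least integer strictly larger than \<open>\<rho>\<close>, hence the first
    sphere that contributes.\<close>
  define j where "j = nat \<lfloor>\<rho>\<rfloor> + 1"
  define c where "c = 3 * \<alpha> / (4 * w)"
  define B where "B = \<alpha> * n * (3 / 2 * w + 11 / 25)"
  have c: "c > 0" using F.alpha_bounds w0 by (simp add: c_def)
  have j: "\<rho> < real k \<longleftrightarrow> j \<le> k" for k
    unfolding j_def using \<rho>0 by linarith
  have "(\<Sum>y | \<rho> < real (dn y). \<mu> y * exp (- \<alpha> * dn y / w))
     = (\<Sum>k\<in>{j..K}. \<Sum>y | y \<in> {y. \<rho> < real (dn y)} \<and> dn y = k. \<mu> y * exp (- \<alpha> * dn y / w))"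
    by (rule sum.group[symmetric]) (auto simp: j K_def)
  also have "\<dots> \<le> (\<Sum>k\<in>{j..K}. A 0 * exp B * exp (- c * \<rho>) * exp (- c) ^ (k - j))"
  proof (rule sum_mono)
    fix k assume "k \<in> {j..K}"
    then have k: "j \<le> k" "\<rho> < real k" using j by auto
    have "(\<Sum>y | y \<in> {y. \<rho> < real (dn y)} \<and> dn y = k. \<mu> y * exp (- \<alpha> * dn y / w))
        = (\<Sum>y | y \<in> {y. \<rho> < real (dn y)} \<and> dn y = k. \<mu> y) * exp (- \<alpha> * k / w)"
      unfolding sum_distrib_right by (intro sum.cong) auto
    also have "\<dots> \<le> V k * exp (- \<alpha> * k / w)"
      unfolding V_def using mu_nonneg by (intro mult_right_mono sum_mono2) auto
    also have "\<dots> \<le> A 0 * exp (\<alpha> * (k / (4 * w) + 3 / 2 * n * w + 11 / 25 * n)) * exp (- \<alpha> * k / w)"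
      using k \<rho> by (intro mult_right_mono growth_exp) auto
    also have "\<dots> = A 0 * exp (B - c * k)"
      using w0 by (simp add: mult.assoc exp_add[symmetric] B_def c_def field_simps)
    also have "\<dots> \<le> A 0 * exp (B - c * (\<rho> + real (k - j)))"
    proof -
      have "\<rho> + real (k - j) \<le> real k" using k \<rho>0 unfolding j_def by linarith
      then show ?thesis using c F.A_pos[of 0] by simp
    qed
    also have "\<dots> = A 0 * exp B * exp (- c * \<rho>) * exp (- c) ^ (k - j)"
      by (simp add: exp_diff exp_add exp_minus distrib_left exp_of_nat2_mult[symmetric] power_inverse field_simps)
    finally show "(\<Sum>y | y \<in> {y. \<rho> < real (dn y)} \<and> dn y = k. \<mu> y * exp (- \<alpha> * dn y / w))
      \<le> A 0 * exp B * exp (- c * \<rho>) * exp (- c) ^ (k - j)" .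
  qed
  also have "\<dots> = A 0 * exp B * exp (- c * \<rho>) * (\<Sum>k\<in>{j..K}. exp (- c) ^ (k - j))"
    by (simp add: sum_distrib_left)
  also have "\<dots> \<le> A 0 * exp B * exp (- c * \<rho>) * (1 + 4 / 3 * w)"
  proof (rule mult_left_mono)
    have "(\<Sum>k\<in>{j..K}. exp (- c) ^ (k - j)) = (\<Sum>i\<in>(\<lambda>k. k - j) ` {j..K}. exp (- c) ^ i)"
      by (subst sum.reindex) (auto simp: inj_on_def)
    also have "\<dots> \<le> (\<Sum>i. exp (- c) ^ i)"
      using c by (intro sum_le_suminf summable_geometric) auto
    also have "\<dots> = 1 / (1 - exp (- c))" using c by (intro suminf_geometric) auto
    also have "\<dots> \<le> 1 + 1 / c"
    proof -
      have "(1 + c) * exp (- c) \<le> 1"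
        using mult_right_mono[OF exp_ge_add_one_self[of c], of "exp (- c)"] by (simp add: exp_minus)
      then have "c \<le> (1 + c) * (1 - exp (- c))" by (simp add: algebra_simps)
      moreover have "1 - exp (- c) > 0" using c by simp
      ultimately show ?thesis using c by (simp add: field_simps)
    qed
    also have "1 / c \<le> 4 / 3 * w"
      using F.alpha_bounds w0 by (simp add: c_def field_simps)
    finally show "(\<Sum>k\<in>{j..K}. exp (- c) ^ (k - j)) \<le> 1 + 4 / 3 * w" by simp
  qed (use F.A_pos[of 0] in simp)
  also have "\<dots> = A 0 * ((1 + 4 / 3 * w) * exp (B - c * \<rho>))"
    by (simp add: exp_diff exp_minus field_simps)
  also have "B - c * \<rho> = - (\<alpha> * n) * (3 / 4 * \<rho> / (n * w) - 3 / 2 * w - 11 / 25)"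
    using w0 n_pos by (simp add: B_def c_def field_simps)
  finally show ?thesis .
qed

section \<open>Doubling for small and for large radii\<close>

lemma P_mono: "0 < p \<Longrightarrow> p \<le> p' \<Longrightarrow> P p \<le> P p'"
  unfolding P_def using F.alpha_bounds n_pos by (intro powr_mono2) auto

text \<open>As \<open>n \<ge> 1\<close>, the exponent
  \<open>\<alpha> * n / 2 = (n + 1/8) / 2\<close> is at most \<open>9/16 * n\<close>.\<close>

lemma P_le_powr:
  assumes p: "0 < p" "exp 1 * p \<le> X" and X: "1 \<le> X" "X ^ 9 \<le> Y ^ 16" "0 < Y"
  shows "P p \<le> Y powr n"
proof -
  have "P p \<le> X powr (\<alpha> * n / 2)"
    unfolding P_def using p F.alpha_bounds n_pos by (intro powr_mono2) auto
  also have "\<dots> \<le> X powr (9 / 16 * n)"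
    using X dimension_ge_1 by (intro powr_mono) (auto simp: alpha_n)
  also have "\<dots> = (X powr (9 / 16)) powr n" by (simp add: powr_powr)
  also have "\<dots> \<le> Y powr n"
    using X n_pos by (intro powr_mono2 powr_9_16_le) auto
  finally show ?thesis .
qed

text \<open>The tent is nonpositive, so the initial density is at most 1 inside the ball.\<close>

lemma V_ge_tail: "A 0 \<le> V r + (\<Sum>y | r < real (dn y). \<mu> y * exp (- \<alpha> * dn y / w))"
proof -
  have "A 0 = (\<Sum>y | real (dn y) \<le> r. \<mu> y * exp (- \<alpha> * dn y / w)) + (\<Sum>y | r < real (dn y). \<mu> y * exp (- \<alpha> * dn y / w))"
    unfolding A0_eq by (subst sum.union_disjoint[symmetric]) (auto intro!: sum.cong)
  moreover have "(\<Sum>y | real (dn y) \<le> r. \<mu> y * exp (- \<alpha> * dn y / w)) \<le> V r"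
    unfolding V_def
  proof (rule sum_mono)
    fix y
    have "exp (- \<alpha> * dn y / w) \<le> 1" using F.alpha_bounds w_ge_1 by simp
    from mult_left_mono[OF this mu_nonneg[of y]] show "\<mu> y * exp (- \<alpha> * dn y / w) \<le> \<mu> y" by simp
  qed
  ultimately show ?thesis by simp
qed

text \<open>The tail is at most 71/100 of \<open>A 0\<close>, so \<open>V r\<close> is at least
  29/100 of it; \<open>growth\<close> at \<open>2 * r\<close> compares \<open>V (2 * r)\<close> with
  \<open>A 0\<close>.\<close>

lemma doubling_small_radius:
  assumes r: "4 * n * w\<^sup>2 \<le> r" "r \<le> 12 * n * w\<^sup>2"
  shows "V (2 * r) / V r \<le> (729 * w ^ 3) powr n"
proof -
  have w0: "w > 0" using w_ge_1 by simp
  have "0 < 4 * n * w\<^sup>2" using n_pos w0 by simp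
  then have r0: "r > 0" using r by linarith
  \<comment> \<open>Expansion about the worst case \<open>w = 1\<close>: the exponent gains
    \<open>27/16 * z\<close> against the \<open>4/7 * z\<close> lost in the prefactor.\<close>
  define z where "z = w - 1"
  have z: "z \<ge> 0" using w_ge_1 by (simp add: z_def)
  have "(1 + 4 / 3 * w) * exp (- (\<alpha> * n) * (3 / 4 * r / (n * w) - 3 / 2 * w - 11 / 25))
      \<le> (7 / 3 * exp (4 / 7 * z)) * exp (- (11925 / 10000) - 27 / 16 * z)"
  proof (rule mult_mono)
    have "1 + 4 / 3 * w = 7 / 3 * (1 + 4 / 7 * z)" by (simp add: z_def field_simps)
    also have "\<dots> \<le> 7 / 3 * exp (4 / 7 * z)" by (intro mult_left_mono exp_ge_add_one_self) simp
    finally show "1 + 4 / 3 * w \<le> 7 / 3 * exp (4 / 7 * z)" .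
    have "3 * w \<le> 3 / 4 * r / (n * w)" using r n_pos w0 by (simp add: field_simps power2_eq_square)
    then have "9 / 8 * (3 / 2 * w - 11 / 25) \<le> (\<alpha> * n) * (3 / 4 * r / (n * w) - 3 / 2 * w - 11 / 25)"
      using dimension_ge_1 w_ge_1 by (intro mult_mono) (auto simp: alpha_n)
    moreover have "9 / 8 * (3 / 2 * w - 11 / 25) = 11925 / 10000 + 27 / 16 * z" by (simp add: z_def field_simps)
    ultimately show "exp (- (\<alpha> * n) * (3 / 4 * r / (n * w) - 3 / 2 * w - 11 / 25)) \<le> exp (- (11925 / 10000) - 27 / 16 * z)"
      by simp
  qed auto
  also have "\<dots> = 7 / 3 * exp (- (11925 / 10000) - 125 / 112 * z)"
    by (simp add: mult.assoc exp_add[symmetric])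
  also have "\<dots> \<le> 7 / 3 * exp (- (11925 / 10000))" using z by simp
  also have "\<dots> \<le> 71 / 100" using exp_1193_ge by (simp add: exp_minus field_simps)
  finally have "A 0 * ((1 + 4 / 3 * w) * exp (- (\<alpha> * n) * (3 / 4 * r / (n * w) - 3 / 2 * w - 11 / 25))) \<le> A 0 * (71 / 100)"
    using F.A_pos[of 0] by (intro mult_left_mono) auto
  then have V: "29 / 100 * A 0 \<le> V r"
    using V_ge_tail[of r] tail[OF r(1)] by linarith
  then have V0: "V r > 0" using F.A_pos[of 0] by linarith
  have p: "1 + 8 * (2 * r)\<^sup>2 * w / n ^ 3 \<le> 4609 * w ^ 5"
  proof -
    have "8 * (2 * r)\<^sup>2 * w / n ^ 3 \<le> 8 * (2 * (12 * n * w\<^sup>2))\<^sup>2 * w / n ^ 3"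
      using r r0 w0 n_pos by (intro divide_right_mono mult_right_mono mult_left_mono power_mono) auto
    also have "\<dots> = 4608 * w ^ 5 / n" using n_pos by (simp add: eval_nat_numeral)
    also have "\<dots> \<le> 4608 * w ^ 5 / 1" using dimension_ge_1 w0 by (intro divide_left_mono) auto
    finally show ?thesis using one_le_power[OF w_ge_1, of 5] by simp
  qed
  have "1 + 8 * (2 * r)\<^sup>2 * w / n ^ 3 > 0" using w0 n_pos by (intro add_pos_nonneg) auto
  from P_mono[OF this p] have "P (1 + 8 * (2 * r)\<^sup>2 * w / n ^ 3) \<le> P (4609 * w ^ 5)" .
  also have "\<dots> \<le> (211 * w ^ 3) powr n"
  proof (rule P_le_powr)
    show "exp 1 * (4609 * w ^ 5) \<le> 13044 * w ^ 5"
      using mult_right_mono[OF exp_1_le, of "4609 * w ^ 5"] w0 by simp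
    show "1 \<le> 13044 * w ^ 5" using one_le_power[OF w_ge_1, of 5] by linarith
    have "w ^ 45 \<le> w ^ 48" using w_ge_1 by (intro power_increasing) auto
    then have "13044 ^ 9 * w ^ 45 \<le> 211 ^ 16 * w ^ 48" using w0 by (intro mult_mono) auto
    then show "(13044 * w ^ 5) ^ 9 \<le> (211 * w ^ 3) ^ 16"
      by (simp add: power_mult_distrib power_mult[symmetric])
  qed (use w0 in auto)
  finally have "V (2 * r) \<le> A 0 * (211 * w ^ 3) powr n"
    using growth[of "2 * r"] r0 F.A_pos[of 0] by (meson mult_left_mono order_trans less_imp_le zero_less_mult_iff zero_less_numeral)
  also have "\<dots> \<le> (100 / 29 * V r) * (211 * w ^ 3) powr n" using V by (intro mult_right_mono) auto
  finally have "V (2 * r) / V r \<le> 100 / 29 * (211 * w ^ 3) powr n" using V0 by (simp add: field_simps)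
  \<comment> \<open>The factor 100/29 is absorbed into the power because \<open>n \<ge> 1\<close>;
    \<open>21100/29\<close> is still below 729.\<close>
  also have "\<dots> \<le> (100 / 29) powr n * (211 * w ^ 3) powr n"
    using dimension_ge_1 powr_mono[of 1 n "100 / 29"] by (intro mult_right_mono) auto
  also have "\<dots> = (21100 / 29 * w ^ 3) powr n" using w0 by (simp add: powr_mult[symmetric])
  also have "\<dots> \<le> (729 * w ^ 3) powr n" using w0 n_pos by (intro powr_mono2 mult_right_mono) auto
  finally show ?thesis .
qed

text \<open>The cutoff \<open>\<psi>\<close> vanishes within distance \<open>r / 2\<close> and is 1
  beyond \<open>r\<close>, so its mean bounds the escaped fraction. By \<open>mean_drift\<close>
  this is at most 7/48 from the initial tail plus a drift of 301/1000, together less than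
  1/2.\<close>

lemma mass_in_ball:
  assumes r: "r \<ge> 12 * n * w\<^sup>2" and t: "t = r\<^sup>2 / (100 * D * n)"
  shows "A t / 2 \<le> (\<Sum>y | real (dn y) \<le> r. \<mu> y * exp (\<alpha> * U t y))"
proof -
  have w0: "w > 0" using w_ge_1 by simp
  have nw: "12 * n * w\<^sup>2 > 0" using n_pos w0 by simp
  then have r0: "r > 0" using r by linarith
  have t0: "t \<ge> 0" using n_pos D_pos by (simp add: t)
  define \<psi> where "\<psi> y = min 1 (max 0 (2 * real (dn y) / r - 1))" for y
  have \<psi>0: "\<psi> y \<ge> 0" for y by (simp add: \<psi>_def)
  have \<psi>lip: "\<bar>\<psi> x - \<psi> y\<bar> \<le> 2 / r" if "q x y > 0" for x y
  proof -
    have "\<bar>\<psi> x - \<psi> y\<bar> \<le> \<bar>2 * real (dn x) / r - 2 * real (dn y) / r\<bar>" unfolding \<psi>_def by linarith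
    also have "2 * real (dn x) / r - 2 * real (dn y) / r = 2 / r * (real (dn x) - real (dn y))"
      by (simp add: right_diff_distrib)
    also have "\<bar>\<dots>\<bar> = 2 / r * \<bar>real (dn x) - real (dn y)\<bar>"
      unfolding abs_mult using r0 by simp
    also have "\<dots> \<le> 2 / r * 1" using dn_lipschitz[of x y] that adj_iff r0 by (intro mult_left_mono) auto
    finally show ?thesis by simp
  qed
  \<comment> \<open>Under the root \<open>t\<close> contributes \<open>r^2/100\<close> and
    \<open>t0\<close> at most \<open>r^2/288\<close>.\<close>
  have drift: "9 / 7 * (2 / r) * sqrt (D * n * (t + t0)) \<le> 301 / 1000"
  proof -
    have "n\<^sup>2 * w \<le> n\<^sup>2 * w ^ 4" using power_increasing[of 1 4 w] w_ge_1 by (intro mult_left_mono) auto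
    moreover have "(12 * n * w\<^sup>2)\<^sup>2 \<le> r\<^sup>2" using r nw by (intro power_mono) auto
    moreover have "(12 * n * w\<^sup>2)\<^sup>2 = 144 * (n\<^sup>2 * w ^ 4)" by (simp add: eval_nat_numeral)
    moreover have "D * n * (t + t0) = r\<^sup>2 / 100 + n\<^sup>2 * w / 2"
      using n_pos D_pos by (simp add: t t0_def field_simps power2_eq_square)
    moreover have "0 \<le> r\<^sup>2" by simp
    moreover have "(117 / 1000 * r)\<^sup>2 = 13689 / 1000000 * r\<^sup>2" by (simp add: power2_eq_square)
    ultimately have "D * n * (t + t0) \<le> (117 / 1000 * r)\<^sup>2"
      by linarith
    then have "sqrt (D * n * (t + t0)) \<le> 117 / 1000 * r"
      using r0 by (intro real_le_lsqrt) auto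
    then have "9 / 7 * (2 / r) * sqrt (D * n * (t + t0)) \<le> 9 / 7 * (2 / r) * (117 / 1000 * r)"
      using r0 by (intro mult_left_mono) auto
    then show ?thesis using r0 by simp
  qed
  \<comment> \<open>Tail and time ratio are both estimated in this variable:
    \<open>w \<le> z / 6\<close> eliminates \<open>w\<close>, and \<open>z = 6\<close> is the worst
    case.\<close>
  define z where "z = r / (2 * n * w)"
  have z6: "z \<ge> 6 * w" using r n_pos w0 by (simp add: z_def field_simps power2_eq_square)
  have z: "z \<ge> 6" using z6 w_ge_1 by linarith
  have init: "F.mass \<psi> 0 / A 0 \<le> (1 + 4 / 3 * w) * exp (- (\<alpha> * n) * (3 / 4 * z - 3 / 2 * w - 11 / 25))"
  proof -
    have "F.mass \<psi> 0 = (\<Sum>y | r / 2 < real (dn y). \<mu> y * (\<psi> y * exp (\<alpha> * U 0 y)))"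
      unfolding F.mass_def using r0 by (intro sum.mono_neutral_right) (auto simp: \<psi>_def field_simps not_less)
    also have "\<dots> \<le> (\<Sum>y | r / 2 < real (dn y). \<mu> y * exp (- \<alpha> * dn y / w))"
    proof (rule sum_mono)
      fix y
      have "\<psi> y * exp (\<alpha> * U 0 y) \<le> 1 * exp (\<alpha> * U 0 y)" by (intro mult_right_mono) (auto simp: \<psi>_def)
      from mult_left_mono[OF this mu_nonneg[of y]]
      show "\<mu> y * (\<psi> y * exp (\<alpha> * U 0 y)) \<le> \<mu> y * exp (- \<alpha> * dn y / w)"
        by (simp add: U0 tent_def)
    qed
    also have "\<dots> \<le> A 0 * ((1 + 4 / 3 * w) * exp (- (\<alpha> * n) * (3 / 4 * (r / 2) / (n * w) - 3 / 2 * w - 11 / 25)))"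
      by (rule tail) (use r nw in linarith)
    also have "3 / 4 * (r / 2) / (n * w) = 3 / 4 * z" by (simp add: z_def)
    finally show ?thesis using F.A_pos[of 0] by (simp add: pos_divide_le_eq mult.commute)
  qed
  have "F.mass \<psi> 0 / A 0 * ((t + t0) / t0) powr (1 / 16)
     \<le> (7 / 3 * exp (2 / 21 * (z - 6)) * exp (- (9 / 8) * (z / 2 - 11 / 25))) * exp ((50 / 36 + 3 * (z / 6 - 1)) / 16)"
  proof (rule mult_mono)
    have "(1 + 4 / 3 * w) * exp (- (\<alpha> * n) * (3 / 4 * z - 3 / 2 * w - 11 / 25))
        \<le> (7 / 3 * exp (2 / 21 * (z - 6))) * exp (- (9 / 8) * (z / 2 - 11 / 25))"
    proof (rule mult_mono)
      have "1 + 4 / 3 * w \<le> 7 / 3 * (1 + 2 / 21 * (z - 6))" using z6 by (simp add: field_simps)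
      also have "\<dots> \<le> 7 / 3 * exp (2 / 21 * (z - 6))" by (intro mult_left_mono exp_ge_add_one_self) simp
      finally show "1 + 4 / 3 * w \<le> 7 / 3 * exp (2 / 21 * (z - 6))" .
      have "9 / 8 * (z / 2 - 11 / 25) \<le> (\<alpha> * n) * (3 / 4 * z - 3 / 2 * w - 11 / 25)"
        using dimension_ge_1 z z6 by (intro mult_mono) (auto simp: alpha_n)
      then show "exp (- (\<alpha> * n) * (3 / 4 * z - 3 / 2 * w - 11 / 25)) \<le> exp (- (9 / 8) * (z / 2 - 11 / 25))"
        by simp
    qed auto
    with init show "F.mass \<psi> 0 / A 0 \<le> 7 / 3 * exp (2 / 21 * (z - 6)) * exp (- (9 / 8) * (z / 2 - 11 / 25))"
      by (rule order_trans)
    have "r = 2 * n * w * z" using n_pos w0 by (simp add: z_def)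
    then have "t / t0 = 2 / 25 * (w * z\<^sup>2)"
      using n_pos w0 D_pos by (simp add: t t0_def field_simps power2_eq_square)
    then have "(t + t0) / t0 = 1 + 2 / 25 * (w * z\<^sup>2)" using t0_pos by (simp add: add_divide_distrib)
    also have "\<dots> \<le> 1 + 2 / 25 * (z / 6 * z\<^sup>2)" using z6 by (intro add_left_mono mult_left_mono mult_right_mono) auto
    also have "\<dots> \<le> 4 * (z / 6) ^ 3"
    proof -
      have "6 ^ 3 \<le> z ^ 3" using z by (intro power_mono) auto
      then show ?thesis by (simp add: power_divide eval_nat_numeral)
    qed
    finally have x: "(t + t0) / t0 \<le> 4 * (z / 6) ^ 3" .
    have x0: "(t + t0) / t0 > 0" using t0 t0_pos by simp
    have "ln ((t + t0) / t0) \<le> ln (4 * (z / 6) ^ 3)"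
      using x x0 ln_le_cancel_iff[OF x0 less_le_trans[OF x0 x]] by blast
    also have "\<dots> = 2 * ln 2 + 3 * ln (z / 6)"
      using z ln_realpow[of "2 :: real" 2] by (simp add: ln_mult ln_realpow)
    also have "\<dots> \<le> 2 * (25 / 36) + 3 * (z / 6 - 1)"
      using z ln2_le_25_over_36 by (intro add_mono mult_left_mono ln_le_minus_one) auto
    finally have "ln ((t + t0) / t0) / 16 \<le> (50 / 36 + 3 * (z / 6 - 1)) / 16" by simp
    then show "((t + t0) / t0) powr (1 / 16) \<le> exp ((50 / 36 + 3 * (z / 6 - 1)) / 16)"
      using x0 by (simp add: powr_def)
  qed auto
  also have "\<dots> = 7 / 3 * exp (2 / 21 * (z - 6) - 9 / 8 * (z / 2 - 11 / 25) + (50 / 36 + 3 * (z / 6 - 1)) / 16)"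
    by (simp add: mult.assoc flip: exp_add)
  \<comment> \<open>The exponent decreases in \<open>z\<close>, and its value at
    \<open>z = 6\<close> is just below \<open>- 25/9\<close>.\<close>
  also have "\<dots> \<le> 7 / 3 * exp (- (4 * (25 / 36)))"
    using z by (simp add: field_simps)
  also have "\<dots> \<le> 7 / 3 * (1 / 16)"
  proof -
    have "2 ^ 4 \<le> exp (25 / 36 :: real) ^ 4" using exp_25_36_ge by (intro power_mono) auto
    also have "\<dots> = exp (4 * (25 / 36))" by (simp only: exp_of_nat_mult[of 4, simplified])
    finally have "16 \<le> exp (4 * (25 / 36 :: real))" by simp
    then have "exp (- (4 * (25 / 36 :: real))) \<le> 1 / 16" by (simp add: exp_minus field_simps)
    then show ?thesis by (intro mult_left_mono) auto
  qed
  finally have "F.mass \<psi> t / A t \<le> 1 / 2"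
    using F.mean_drift[OF t0 \<psi>0 \<psi>lip] r0 drift by fastforce
  then have half: "F.mass \<psi> t \<le> A t / 2" using F.A_pos[of t] by (simp add: pos_divide_le_eq)
  have "A t = (\<Sum>y | real (dn y) \<le> r. \<mu> y * exp (\<alpha> * U t y)) + (\<Sum>y | r < real (dn y). \<mu> y * exp (\<alpha> * U t y))"
    unfolding F.mass_def by (subst sum.union_disjoint[symmetric]) (auto intro!: sum.cong)
  moreover have "(\<Sum>y | r < real (dn y). \<mu> y * exp (\<alpha> * U t y)) \<le> F.mass \<psi> t"
  proof -
    have "(\<Sum>y | r < real (dn y). \<mu> y * exp (\<alpha> * U t y)) = (\<Sum>y | r < real (dn y). \<mu> y * (\<psi> y * exp (\<alpha> * U t y)))"
      using r0 by (intro sum.cong) (auto simp: \<psi>_def field_simps)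
    also have "\<dots> \<le> F.mass \<psi> t"
      unfolding F.mass_def using mu_nonneg \<psi>0 by (intro sum_mono2) auto
    finally show ?thesis .
  qed
  ultimately show ?thesis using half by linarith
qed

text \<open>Harnack from all \<open>z\<close> in the ball of radius \<open>r\<close> to a fixed
  \<open>y\<close> in the double ball is summed over \<open>z\<close> and bounds
  \<open>exp (\<alpha> * u)\<close> at \<open>y\<close> below by \<open>M / (P p * V r)\<close>.
  Summing over \<open>y\<close> and using \<open>A (t + S) \<le> A t \<le> 2 * M\<close> bounds the
  volume ratio by \<open>2 * P p\<close>.\<close>

lemma doubling_large_radius:
  assumes r: "r \<ge> 12 * n * w\<^sup>2"
  shows "V (2 * r) / V r \<le> (729 * w ^ 3) powr n"
proof -
  have w0: "w > 0" using w_ge_1 by simp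
  have "12 * n * w\<^sup>2 > 0" using n_pos w0 by simp
  then have r0: "r > 0" using r by linarith
  define t where "t = r\<^sup>2 / (100 * D * n)"
  \<comment> \<open>As with \<open>T\<close> in \<open>growth\<close>, but for paths of length at
    most \<open>3 * r\<close>: the path term is again \<open>n / 2\<close>.\<close>
  define S where "S = 36 * r\<^sup>2 * w\<^sup>2 / (n\<^sup>2 * D)"
  define p where "p = (t + S + t0) / (t + t0)"
  have t: "t > 0" and S: "S > 0" using r0 n_pos D_pos w0 by (simp_all add: t_def S_def)
  have p0: "p > 0" using t S t0_pos by (simp add: p_def)
  have "p = 1 + S / (t + t0)" using t t0_pos by (simp add: p_def field_simps)
  also have "\<dots> \<le> 1 + S / t" using t S t0_pos by (intro add_left_mono divide_left_mono) auto
  also have "S / t = 3600 * w\<^sup>2 / n" using r0 n_pos D_pos by (simp add: S_def t_def field_simps power2_eq_square)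
  also have "\<dots> \<le> 3600 * w\<^sup>2 / 1" using dimension_ge_1 by (intro divide_left_mono) auto
  finally have p: "p \<le> 3601 * w\<^sup>2" using one_le_power[OF w_ge_1, of 2] by simp
  have c: "2 * (3 * r)\<^sup>2 / (Q * (t + S - t)) = n / 2"
    using r0 n_pos w0 D_pos by (simp add: S_def Q_eq field_simps power2_eq_square)
  define M where "M = (\<Sum>z | real (dn z) \<le> r. \<mu> z * exp (\<alpha> * U t z))"
  have M: "A t / 2 \<le> M" unfolding M_def by (rule mass_in_ball[OF r]) (simp add: t_def)
  have M0: "M > 0" using M F.A_pos[of t] by linarith
  have ptw: "M \<le> P p * (V r * exp (\<alpha> * U (t + S) y))" if y: "reachable y" "real (dn y) \<le> 2 * r" for y
  proof -
    have "\<mu> z * exp (\<alpha> * U t z) \<le> \<mu> z * (P p * exp (\<alpha> * U (t + S) y))" if z: "real (dn z) \<le> r" for z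
    proof (cases "reachable z")
      case True
      have "U t z - n / 2 * ln ((t + S + t0) / (t + t0)) - 2 * (3 * r)\<^sup>2 / (Q * (t + S - t)) \<le> U (t + S) y"
        by (rule F.Harnack[OF path_between[OF True y(1)]]) (use y z t S in auto)
      then have "U t z \<le> (n / 2 * ln p + n / 2) + U (t + S) y"
        unfolding c p_def by linarith
      then have "\<alpha> * U t z \<le> \<alpha> * ((n / 2 * ln p + n / 2) + U (t + S) y)"
        using F.alpha_bounds by (intro mult_left_mono) auto
      then have "exp (\<alpha> * U t z) \<le> P p * exp (\<alpha> * U (t + S) y)"
        unfolding P_eq[OF p0] exp_add[symmetric] by (simp only: exp_le_cancel_iff distrib_left)
      then show ?thesis using mu_nonneg by (rule mult_left_mono)
    qed (simp add: \<mu>_def)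
    then have "M \<le> (\<Sum>z | real (dn z) \<le> r. \<mu> z * (P p * exp (\<alpha> * U (t + S) y)))"
      unfolding M_def by (intro sum_mono) auto
    also have "\<dots> = P p * (V r * exp (\<alpha> * U (t + S) y))"
      unfolding V_def sum_distrib_left sum_distrib_right by (simp add: mult_ac)
    finally show ?thesis .
  qed
  have Vr: "V r \<ge> 0" unfolding V_def using mu_nonneg by (intro sum_nonneg) auto
  have "V (2 * r) * M = (\<Sum>y | real (dn y) \<le> 2 * r. \<mu> y * M)" by (simp add: V_def sum_distrib_right)
  also have "\<dots> \<le> (\<Sum>y | real (dn y) \<le> 2 * r. \<mu> y * (P p * (V r * exp (\<alpha> * U (t + S) y))))"
  proof (rule sum_mono)
    fix y assume "y \<in> {y. real (dn y) \<le> 2 * r}"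
    then show "\<mu> y * M \<le> \<mu> y * (P p * (V r * exp (\<alpha> * U (t + S) y)))"
      using mult_left_mono[OF ptw[of y] mu_nonneg[of y]] by (cases "reachable y") (simp_all add: \<mu>_def)
  qed
  also have "\<dots> = P p * V r * (\<Sum>y | real (dn y) \<le> 2 * r. \<mu> y * exp (\<alpha> * U (t + S) y))"
    by (simp add: sum_distrib_left mult_ac)
  also have "\<dots> \<le> P p * V r * A (t + S)"
    using P_pos[OF p0] Vr mu_nonneg unfolding F.mass_def by (intro mult_left_mono) (auto intro!: sum_mono2)
  also have "\<dots> \<le> P p * V r * (2 * M)"
    using P_pos[OF p0] Vr M F.A_antimono[of t "t + S"] t S by (intro mult_left_mono) auto
  finally have "V (2 * r) * M \<le> (2 * P p * V r) * M" by (simp add: mult_ac)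
  then have main: "V (2 * r) \<le> 2 * P p * V r" using M0 by (simp only: mult_le_cancel_right_pos)
  have "P p \<le> P (3601 * w\<^sup>2)" by (rule P_mono[OF p0 p])
  also have "\<dots> \<le> (364 * w ^ 3) powr n"
  proof (rule P_le_powr)
    show "exp 1 * (3601 * w\<^sup>2) \<le> 10191 * w\<^sup>2"
    proof -
      have "exp 1 * (3601 * w\<^sup>2) \<le> 283 / 100 * (3601 * w\<^sup>2)" by (intro mult_right_mono exp_1_le) simp
      also have "\<dots> \<le> 10191 * w\<^sup>2" by simp
      finally show ?thesis .
    qed
    show "1 \<le> 10191 * w\<^sup>2" using one_le_power[OF w_ge_1, of 2] by linarith
    have "w ^ 18 \<le> w ^ 48" using w_ge_1 by (intro power_increasing) auto
    then have "10191 ^ 9 * w ^ 18 \<le> 364 ^ 16 * w ^ 48" using w0 by (intro mult_mono) auto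
    then show "(10191 * w\<^sup>2) ^ 9 \<le> (364 * w ^ 3) ^ 16"
      by (simp add: power_mult_distrib power_mult[symmetric])
  qed (use w0 in auto)
  finally have P: "P p \<le> (364 * w ^ 3) powr n" .
  have "2 * P p \<le> 2 powr n * (364 * w ^ 3) powr n"
    using dimension_ge_1 powr_mono[of 1 n 2] P P_pos[OF p0] by (intro mult_mono) auto
  also have "\<dots> = (728 * w ^ 3) powr n" using w0 by (simp add: powr_mult[symmetric])
  also have "\<dots> \<le> (729 * w ^ 3) powr n" using w0 n_pos by (intro powr_mono2 mult_right_mono) auto
  finally have "2 * P p \<le> (729 * w ^ 3) powr n" .
  have "V (2 * r) \<le> (729 * w ^ 3) powr n * V r"
    using main mult_right_mono[OF \<open>2 * P p \<le> (729 * w ^ 3) powr n\<close> Vr] by linarith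
  moreover have "V r > 0"
  proof -
    have "\<mu> x0 \<le> V r" unfolding V_def
      using r0 mu_nonneg by (intro member_le_sum) (auto simp: dn_x0)
    then show ?thesis using m_pos[of x0] reachable_x0 by (simp add: \<mu>_def)
  qed
  ultimately show ?thesis by (simp add: pos_divide_le_eq)
qed

end

text \<open>Both ranges of radii give the base \<open>9 * w\<close> with
  \<open>w = sqrt (n * D / Q)\<close>, since \<open>729 = 9^3\<close>; the stated form follows from
  \<open>sqrt n \<le> n\<close>.\<close>

theorem theorem4p1:
  fixes q :: "'v::finite \<Rightarrow> 'v \<Rightarrow> real" and m :: "'v \<Rightarrow> real"
    and n r :: real and x :: 'v
  assumes "finite_graph q"
    and "\<exists>u v. q u v > 0"
    and "reversible_measure q m"
    and "n > 0"
    and "CD q 0 (ereal n)"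
    and "r \<ge> 4 * n\<^sup>2 * maxdeg q / qmin q"
  shows "vol m (gball q (2 * r) x) / vol m (gball q r x)
           \<le> (9 * n * sqrt (maxdeg q / qmin q)) powr (3 * n)"
proof -
  interpret pointed_cd_graph q m n x
    by unfold_locales (use assms in auto)
  obtain U where "U 0 = tent" "li_yau_flow q m n U t0 \<mu>" using cone_flow_exists by blast
  then interpret cone_flow q m n x U by unfold_locales (auto simp: li_yau_flow_def li_yau_flow_axioms_def)
  have w0: "w > 0" using w_ge_1 by simp
  have r: "4 * n * w\<^sup>2 \<le> r" using assms(6) unfolding w_sq by (simp add: power2_eq_square mult.assoc)
  have "V (2 * r) / V r \<le> (729 * w ^ 3) powr n"
    using doubling_small_radius[OF r] doubling_large_radius[of r] by linarith
  also have "729 * w ^ 3 = (9 * w) powr 3" using w0 by (simp add: power_mult_distrib)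
  also have "\<dots> powr n = (9 * w) powr (3 * n)" by (simp add: powr_powr)
  also have "\<dots> \<le> (9 * n * sqrt (D / Q)) powr (3 * n)"
  proof (rule powr_mono2)
    have "sqrt n * 1 \<le> sqrt n * sqrt n" using dimension_ge_1 by (intro mult_left_mono) auto
    then have "sqrt n \<le> n" using n_pos by simp
    then have "sqrt n * sqrt (D / Q) \<le> n * sqrt (D / Q)"
      using D_pos Q_pos by (intro mult_right_mono) auto
    moreover have "w = sqrt n * sqrt (D / Q)" unfolding w_def real_sqrt_mult[symmetric] by simp
    ultimately show "9 * w \<le> 9 * n * sqrt (D / Q)" by simp
  qed (use n_pos w0 in auto)
  finally show ?thesis unfolding vol_gball .
qed

end
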